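(* Suppose that $(C,\Delta,P)$ is a Rota-Baxter coalgebra of weight $\lambda\in\mathbb{K}$ and $(M,p,\rho)$ is a right $(C,\Delta,P)$-comodule. If $p$ is a comodule morphism, then the rational $C^\ast$-module $M$, equipped with $p$, is a left Rota-Baxter module over the Rota-Baxter algebra $(C^\ast,P^\ast)$.
   Context: $\mathbb{K}$ is a fixed ground field of characteristic 0; all vector spaces, algebras, coalgebras and tensor products are over $\mathbb{K}$. A Rota-Baxter coalgebra of weight $\lambda$ is a coalgebra $(C,\Delta)$ with a linear operator $P:C\to C$ such that $(P\otimes P)\Delta=(\mathrm{id}\otimes P)\Delta P+(P\otimes\mathrm{id})\Delta P+\lambda\Delta P$. A right $(C,\Delta,P)$-comodule (right Rota-Baxter comodule) $(M,p,\rho)$ is a right $C$-comodule $(M,\rho)$, $\rho:M\to M\otimes C$, $\rho(m)=\sum m_{(0)}\otimes m_{(1)}$, together with a linear endomorphism $p$ of $M$ such that $(p\otimes P)\rho=(p\otimes\mathrm{id})\rho p+(\mathrm{id}\otimes P)\rho p+\lambda\rho p$. That $p$ is a comodule morphism means $\rho p=(p\otimes\mathrm{id})\rho$. $C^\ast=\mathrm{Hom}_{\mathbb{K}}(C,\mathbb{K})$ has the convolution product $(fg)(c)=\sum f(c_{(1)})g(c_{(2)})$, where $\Delta(c)=\sum c_{(1)}\otimes c_{(2)}$, and $P^\ast(f)=f\circ P$; $(C^\ast,P^\ast)$ is a Rota-Baxter algebra of weight $\lambda$, i.e. $P^\ast(x)P^\ast(y)=P^\ast(xP^\ast(y))+P^\ast(P^\ast(x)y)+\lambda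 P^\ast(xy)$. The rational $C^\ast$-module of $(M,\rho)$ is $M$ with the left action $c^\ast.m=\sum c^\ast(m_{(1)})m_{(0)}$. A left Rota-Baxter module $(M,p)$ over a Rota-Baxter algebra $(R,Q)$ of weight $\lambda$ is a left $R$-module $M$ with a linear endomorphism $p$ such that $Q(a)p(x)=p(ap(x))+p(Q(a)x)+\lambda p(ax)$ for all $a\in R$, $x\in M$. *)

theory Defs
  imports "HOL-Algebra.QuotRing" "Jordan_Normal_Form.Missing_VectorSpace"
begin

section \<open>Tensor products of vector spaces\<close>

locale char_0_field = field K for K (structure) +
  assumes char_0: "n > 0 \<Longrightarrow> add_pow K (n::nat) \<one> \<noteq> \<zero>"

definition self_space :: "('k, 'e) ring_scheme \<Rightarrow> ('k, 'k) module" where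
  "self_space K = \<lparr>carrier = carrier K, mult = mult K, one = one K, zero = zero K, add = add K,
     smult = mult K\<rparr>"

definition free_space :: "('k, 'e) ring_scheme \<Rightarrow> 's set \<Rightarrow> ('k, 's \<Rightarrow> 'k) module" where
  "free_space K S = (ring.func_space K S)
     \<lparr>carrier := {f \<in> S \<rightarrow>\<^sub>E carrier K. finite {s \<in> S. f s \<noteq> \<zero>\<^bsub>K\<^esub>}}\<rparr>"

definition free_gen :: "('k, 'e) ring_scheme \<Rightarrow> 's set \<Rightarrow> 's \<Rightarrow> 's \<Rightarrow> 'k" where
  "free_gen K S s = (\<lambda>t\<in>S. if t = s then \<one>\<^bsub>K\<^esub> else \<zero>\<^bsub>K\<^esub>)"

text \<open>As in \<^const>\<open>FactRing\<close>, the elements are additive cosets. The fields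
  \<^const>\<open>mult\<close> and \<^const>\<open>one\<close> of a module record play no role for a vector space and are
  filled with junk.\<close>

definition quot_space :: "('k, 'v, 'e) module_scheme \<Rightarrow> 'v set \<Rightarrow> ('k, 'v set) module" where
  "quot_space V N = \<lparr>carrier = a_rcosets\<^bsub>V\<^esub> N, mult = (\<lambda>_ _. N), one = N, zero = N, add = set_add V,
     smult = (\<lambda>k A. \<Union>v\<in>A. N +>\<^bsub>V\<^esub> (k \<odot>\<^bsub>V\<^esub> v))\<rparr>"

definition tensor_rels ::
  "('k, 'e) ring_scheme \<Rightarrow> ('k, 'v, 'f) module_scheme \<Rightarrow> ('k, 'w, 'g) module_scheme \<Rightarrow>
   ('v \<times> 'w \<Rightarrow> 'k) set" where
  "tensor_rels K V W =
     (let F = free_space K (carrier V \<times> carrier W);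
          d = (\<lambda>v w. free_gen K (carrier V \<times> carrier W) (v, w))
      in {d (v \<oplus>\<^bsub>V\<^esub> v') w \<ominus>\<^bsub>F\<^esub> (d v w \<oplus>\<^bsub>F\<^esub> d v' w) | v v' w.
             v \<in> carrier V \<and> v' \<in> carrier V \<and> w \<in> carrier W}
       \<union> {d v (w \<oplus>\<^bsub>W\<^esub> w') \<ominus>\<^bsub>F\<^esub> (d v w \<oplus>\<^bsub>F\<^esub> d v w') | v w w'.
             v \<in> carrier V \<and> w \<in> carrier W \<and> w' \<in> carrier W}
       \<union> {d (k \<odot>\<^bsub>V\<^esub> v) w \<ominus>\<^bsub>F\<^esub> (k \<odot>\<^bsub>F\<^esub> d v w) | k v w.
             k \<in> carrier K \<and> v \<in> carrier V \<and> w \<in> carrier W}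
       \<union> {d v (k \<odot>\<^bsub>W\<^esub> w) \<ominus>\<^bsub>F\<^esub> (k \<odot>\<^bsub>F\<^esub> d v w) | k v w.
             k \<in> carrier K \<and> v \<in> carrier V \<and> w \<in> carrier W})"

definition tensor_null ::
  "('k, 'e) ring_scheme \<Rightarrow> ('k, 'v, 'f) module_scheme \<Rightarrow> ('k, 'w, 'g) module_scheme \<Rightarrow>
   ('v \<times> 'w \<Rightarrow> 'k) set" where
  "tensor_null K V W =
     module.span K (free_space K (carrier V \<times> carrier W)) (tensor_rels K V W)"

definition tensor ::
  "('k, 'e) ring_scheme \<Rightarrow> ('k, 'v, 'f) module_scheme \<Rightarrow> ('k, 'w, 'g) module_scheme \<Rightarrow>
   ('k, ('v \<times> 'w \<Rightarrow> 'k) set) module" where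
  "tensor K V W = quot_space (free_space K (carrier V \<times> carrier W)) (tensor_null K V W)"

definition pure_tensor ::
  "('k, 'e) ring_scheme \<Rightarrow> ('k, 'v, 'f) module_scheme \<Rightarrow> ('k, 'w, 'g) module_scheme \<Rightarrow>
   'v \<Rightarrow> 'w \<Rightarrow> ('v \<times> 'w \<Rightarrow> 'k) set" where
  "pure_tensor K V W v w =
     tensor_null K V W +>\<^bsub>free_space K (carrier V \<times> carrier W)\<^esub>
       free_gen K (carrier V \<times> carrier W) (v, w)"

text \<open>For a bilinear map \<open>b : V \<times> W \<rightarrow> U\<close>, \<open>tensor_lift K V W U b\<close> is the induced linear map
  \<open>V \<otimes> W \<rightarrow> U\<close>: pick any representative \<open>\<Sum> k\<^sub>i (v\<^sub>i, w\<^sub>i)\<close> of the tensor and form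
  \<open>\<Sum> k\<^sub>i b v\<^sub>i w\<^sub>i\<close>, which does not depend on the choice. In Sweedler notation,
  \<open>\<Sum> b c\<^sub>1 c\<^sub>2\<close> is \<open>tensor_lift K C C U b (\<Delta> c)\<close>.\<close>

definition tensor_lift ::
  "('k, 'e) ring_scheme \<Rightarrow> ('k, 'v, 'f) module_scheme \<Rightarrow> ('k, 'w, 'g) module_scheme \<Rightarrow>
   ('k, 'u, 'h) module_scheme \<Rightarrow> ('v \<Rightarrow> 'w \<Rightarrow> 'u) \<Rightarrow> ('v \<times> 'w \<Rightarrow> 'k) set \<Rightarrow> 'u" where
  "tensor_lift K V W U b X =
     (let x = (SOME x. x \<in> X)
      in \<Oplus>\<^bsub>U\<^esub>s\<in>{s \<in> carrier V \<times> carrier W. x s \<noteq> \<zero>\<^bsub>K\<^esub>}. x s \<odot>\<^bsub>U\<^esub> b (fst s) (snd s))"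

text \<open>\<open>tensor_map K V W V' W' f g\<close> is \<open>f \<otimes> g : V \<otimes> W \<rightarrow> V' \<otimes> W'\<close>.\<close>

definition tensor_map ::
  "('k, 'e) ring_scheme \<Rightarrow> ('k, 'v, 'f) module_scheme \<Rightarrow> ('k, 'w, 'g) module_scheme \<Rightarrow>
   ('k, 'x, 'h) module_scheme \<Rightarrow> ('k, 'y, 'i) module_scheme \<Rightarrow>
   ('v \<Rightarrow> 'x) \<Rightarrow> ('w \<Rightarrow> 'y) \<Rightarrow> ('v \<times> 'w \<Rightarrow> 'k) set \<Rightarrow> ('x \<times> 'y \<Rightarrow> 'k) set" where
  "tensor_map K V W V' W' f g =
     tensor_lift K V W (tensor K V' W') (\<lambda>v w. pure_tensor K V' W' (f v) (g w))"

text \<open>The canonical map \<open>U \<otimes> (V \<otimes> W) \<rightarrow> (U \<otimes> V) \<otimes> W\<close>, needed because the two iterated tensor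
  products are different sets.\<close>

definition tensor_assoc ::
  "('k, 'e) ring_scheme \<Rightarrow> ('k, 'u, 'f) module_scheme \<Rightarrow> ('k, 'v, 'g) module_scheme \<Rightarrow>
   ('k, 'w, 'h) module_scheme \<Rightarrow> ('u \<times> ('v \<times> 'w \<Rightarrow> 'k) set \<Rightarrow> 'k) set \<Rightarrow>
   (('u \<times> 'v \<Rightarrow> 'k) set \<times> 'w \<Rightarrow> 'k) set" where
  "tensor_assoc K U V W =
     (let T = tensor K (tensor K U V) W
      in tensor_lift K U (tensor K V W) T
           (\<lambda>u. tensor_lift K V W T
              (\<lambda>v w. pure_tensor K (tensor K U V) W (pure_tensor K U V u v) w)))"


section \<open>Coalgebras and comodules\<close>

text \<open>Coalgebras and comodules are coassociative; a counit is separate data and is not assumed to exist.\<close>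

locale coalgebra = vectorspace K C
    for K :: "('k, 'e) ring_scheme"
    and C :: "('k, 'c, 'f) module_scheme" +
  fixes \<Delta> :: "'c \<Rightarrow> ('c \<times> 'c \<Rightarrow> 'k) set"
  assumes comult_hom: "\<Delta> \<in> module_hom K C (tensor K C C)"
    and coassoc: "c \<in> carrier C \<Longrightarrow>
      tensor_map K C C (tensor K C C) C \<Delta> (\<lambda>x. x) (\<Delta> c) =
      tensor_assoc K C C C (tensor_map K C C C (tensor K C C) (\<lambda>x. x) \<Delta> (\<Delta> c))"

text \<open>The last two clauses are \<open>(\<epsilon> \<otimes> id)\<Delta> = id = (id \<otimes> \<epsilon>)\<Delta>\<close>, modulo the identifications
  \<open>K \<otimes> C = C = C \<otimes> K\<close>.\<close>

definition is_counit ::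
  "('k, 'e) ring_scheme \<Rightarrow> ('k, 'c, 'f) module_scheme \<Rightarrow> ('c \<Rightarrow> ('c \<times> 'c \<Rightarrow> 'k) set) \<Rightarrow>
   ('c \<Rightarrow> 'k) \<Rightarrow> bool" where
  "is_counit K C \<Delta> \<epsilon> \<longleftrightarrow> \<epsilon> \<in> module_hom K C (self_space K) \<and>
     (\<forall>c\<in>carrier C. tensor_lift K C C C (\<lambda>a b. \<epsilon> a \<odot>\<^bsub>C\<^esub> b) (\<Delta> c) = c) \<and>
     (\<forall>c\<in>carrier C. tensor_lift K C C C (\<lambda>a b. \<epsilon> b \<odot>\<^bsub>C\<^esub> a) (\<Delta> c) = c)"

locale right_comodule = C: coalgebra K C \<Delta> + M: vectorspace K M
    for K :: "('k, 'e) ring_scheme"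
    and C :: "('k, 'c, 'f) module_scheme"
    and \<Delta> :: "'c \<Rightarrow> ('c \<times> 'c \<Rightarrow> 'k) set"
    and M :: "('k, 'm, 'g) module_scheme" +
  fixes \<rho> :: "'m \<Rightarrow> ('m \<times> 'c \<Rightarrow> 'k) set"
  assumes coact_hom: "\<rho> \<in> module_hom K M (tensor K M C)"
    and coact_coassoc: "m \<in> carrier M \<Longrightarrow>
      tensor_map K M C (tensor K M C) C \<rho> (\<lambda>x. x) (\<rho> m) =
      tensor_assoc K M C C (tensor_map K M C M (tensor K C C) (\<lambda>x. x) \<Delta> (\<rho> m))"

definition is_counital ::
  "('k, 'e) ring_scheme \<Rightarrow> ('k, 'c, 'f) module_scheme \<Rightarrow> ('k, 'm, 'g) module_scheme \<Rightarrow>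
   ('m \<Rightarrow> ('m \<times> 'c \<Rightarrow> 'k) set) \<Rightarrow> ('c \<Rightarrow> 'k) \<Rightarrow> bool" where
  "is_counital K C M \<rho> \<epsilon> \<longleftrightarrow>
     (\<forall>m\<in>carrier M. tensor_lift K M C M (\<lambda>x c. \<epsilon> c \<odot>\<^bsub>M\<^esub> x) (\<rho> m) = m)"

definition comodule_morphism ::
  "('k, 'e) ring_scheme \<Rightarrow> ('k, 'c, 'f) module_scheme \<Rightarrow>
   ('k, 'm, 'g) module_scheme \<Rightarrow> ('m \<Rightarrow> ('m \<times> 'c \<Rightarrow> 'k) set) \<Rightarrow>
   ('k, 'n, 'h) module_scheme \<Rightarrow> ('n \<Rightarrow> ('n \<times> 'c \<Rightarrow> 'k) set) \<Rightarrow> ('m \<Rightarrow> 'n) \<Rightarrow> bool" where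
  "comodule_morphism K C M \<rho> N \<sigma> f \<longleftrightarrow> f \<in> module_hom K M N \<and>
     (\<forall>m\<in>carrier M. \<sigma> (f m) = tensor_map K M C N C f (\<lambda>x. x) (\<rho> m))"

locale rota_baxter_coalgebra = coalgebra K C \<Delta>
    for K :: "('k, 'e) ring_scheme"
    and C :: "('k, 'c, 'f) module_scheme"
    and \<Delta> :: "'c \<Rightarrow> ('c \<times> 'c \<Rightarrow> 'k) set" +
  fixes P :: "'c \<Rightarrow> 'c" and lam :: 'k
  assumes weight: "lam \<in> carrier K"
    and P_hom: "P \<in> module_hom K C C"
    and rota_baxter: "c \<in> carrier C \<Longrightarrow>
      tensor_map K C C C C P P (\<Delta> c) =
        tensor_map K C C C C (\<lambda>x. x) P (\<Delta> (P c))
        \<oplus>\<^bsub>tensor K C C\<^esub> tensor_map K C C C C P (\<lambda>x. x) (\<Delta> (P c))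
        \<oplus>\<^bsub>tensor K C C\<^esub> lam \<odot>\<^bsub>tensor K C C\<^esub> \<Delta> (P c)"

locale right_rota_baxter_comodule =
  C: rota_baxter_coalgebra K C \<Delta> P lam + right_comodule K C \<Delta> M \<rho>
    for K :: "('k, 'e) ring_scheme"
    and C :: "('k, 'c, 'f) module_scheme"
    and \<Delta> :: "'c \<Rightarrow> ('c \<times> 'c \<Rightarrow> 'k) set"
    and P lam
    and M :: "('k, 'm, 'g) module_scheme"
    and \<rho> :: "'m \<Rightarrow> ('m \<times> 'c \<Rightarrow> 'k) set" +
  fixes p :: "'m \<Rightarrow> 'm"
  assumes p_hom: "p \<in> module_hom K M M"
    and rota_baxter_comod: "m \<in> carrier M \<Longrightarrow>
      tensor_map K M C M C p P (\<rho> m) =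
        tensor_map K M C M C p (\<lambda>x. x) (\<rho> (p m))
        \<oplus>\<^bsub>tensor K M C\<^esub> tensor_map K M C M C (\<lambda>x. x) P (\<rho> (p m))
        \<oplus>\<^bsub>tensor K M C\<^esub> lam \<odot>\<^bsub>tensor K M C\<^esub> \<rho> (p m)"


section \<open>Rota-Baxter algebras and modules\<close>

text \<open>Algebras are associative and not required to be unital; the field \<^const>\<open>one\<close> of \<open>A\<close>
  is ignored.\<close>

locale assoc_algebra = vectorspace K A
    for K :: "('k, 'e) ring_scheme"
    and A :: "('k, 'a, 'f) module_scheme" (structure) +
  assumes mult_closed: "\<lbrakk>x \<in> carrier A; y \<in> carrier A\<rbrakk> \<Longrightarrow> x \<otimes> y \<in> carrier A"
    and mult_assoc: "\<lbrakk>x \<in> carrier A; y \<in> carrier A; z \<in> carrier A\<rbrakk> \<Longrightarrow>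
      (x \<otimes> y) \<otimes> z = x \<otimes> (y \<otimes> z)"
    and mult_add_left: "\<lbrakk>x \<in> carrier A; y \<in> carrier A; z \<in> carrier A\<rbrakk> \<Longrightarrow>
      (x \<oplus> y) \<otimes> z = (x \<otimes> z) \<oplus> (y \<otimes> z)"
    and mult_add_right: "\<lbrakk>x \<in> carrier A; y \<in> carrier A; z \<in> carrier A\<rbrakk> \<Longrightarrow>
      x \<otimes> (y \<oplus> z) = (x \<otimes> y) \<oplus> (x \<otimes> z)"
    and mult_smult_left: "\<lbrakk>k \<in> carrier K; x \<in> carrier A; y \<in> carrier A\<rbrakk> \<Longrightarrow>
      (k \<odot> x) \<otimes> y = k \<odot> (x \<otimes> y)"
    and mult_smult_right: "\<lbrakk>k \<in> carrier K; x \<in> carrier A; y \<in> carrier A\<rbrakk> \<Longrightarrow>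
      x \<otimes> (k \<odot> y) = k \<odot> (x \<otimes> y)"

locale rota_baxter_algebra = assoc_algebra K A
    for K :: "('k, 'e) ring_scheme"
    and A :: "('k, 'a, 'f) module_scheme" (structure) +
  fixes Q :: "'a \<Rightarrow> 'a" and lam :: 'k
  assumes weight: "lam \<in> carrier K"
    and Q_hom: "Q \<in> module_hom K A A"
    and rota_baxter: "\<lbrakk>x \<in> carrier A; y \<in> carrier A\<rbrakk> \<Longrightarrow>
      Q x \<otimes> Q y = Q (x \<otimes> Q y) \<oplus> Q (Q x \<otimes> y) \<oplus> lam \<odot> Q (x \<otimes> y)"

locale left_module = A: assoc_algebra K A + M: vectorspace K M
    for K :: "('k, 'e) ring_scheme"
    and A :: "('k, 'a, 'f) module_scheme"
    and M :: "('k, 'm, 'g) module_scheme" +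
  fixes act :: "'a \<Rightarrow> 'm \<Rightarrow> 'm"
  assumes act_closed: "\<lbrakk>a \<in> carrier A; x \<in> carrier M\<rbrakk> \<Longrightarrow> act a x \<in> carrier M"
    and act_assoc: "\<lbrakk>a \<in> carrier A; b \<in> carrier A; x \<in> carrier M\<rbrakk> \<Longrightarrow>
      act (a \<otimes>\<^bsub>A\<^esub> b) x = act a (act b x)"
    and act_add_left: "\<lbrakk>a \<in> carrier A; b \<in> carrier A; x \<in> carrier M\<rbrakk> \<Longrightarrow>
      act (a \<oplus>\<^bsub>A\<^esub> b) x = act a x \<oplus>\<^bsub>M\<^esub> act b x"
    and act_add_right: "\<lbrakk>a \<in> carrier A; x \<in> carrier M; y \<in> carrier M\<rbrakk> \<Longrightarrow>
      act a (x \<oplus>\<^bsub>M\<^esub> y) = act a x \<oplus>\<^bsub>M\<^esub> act a y"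
    and act_smult_left: "\<lbrakk>k \<in> carrier K; a \<in> carrier A; x \<in> carrier M\<rbrakk> \<Longrightarrow>
      act (k \<odot>\<^bsub>A\<^esub> a) x = k \<odot>\<^bsub>M\<^esub> act a x"
    and act_smult_right: "\<lbrakk>k \<in> carrier K; a \<in> carrier A; x \<in> carrier M\<rbrakk> \<Longrightarrow>
      act a (k \<odot>\<^bsub>M\<^esub> x) = k \<odot>\<^bsub>M\<^esub> act a x"

definition is_algebra_unit :: "('b, 'e) ring_scheme \<Rightarrow> 'b \<Rightarrow> bool" where
  "is_algebra_unit A e \<longleftrightarrow> e \<in> carrier A \<and> (\<forall>a\<in>carrier A. e \<otimes>\<^bsub>A\<^esub> a = a \<and> a \<otimes>\<^bsub>A\<^esub> e = a)"

locale left_rota_baxter_module =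
  A: rota_baxter_algebra K A Q lam + left_module K A M act
    for K :: "('k, 'e) ring_scheme"
    and A :: "('k, 'a, 'f) module_scheme"
    and Q lam
    and M :: "('k, 'm, 'g) module_scheme"
    and act +
  fixes p :: "'m \<Rightarrow> 'm"
  assumes p_hom: "p \<in> module_hom K M M"
    and rota_baxter_mod: "\<lbrakk>a \<in> carrier A; x \<in> carrier M\<rbrakk> \<Longrightarrow>
      act (Q a) (p x) =
        p (act a (p x)) \<oplus>\<^bsub>M\<^esub> p (act (Q a) x) \<oplus>\<^bsub>M\<^esub> lam \<odot>\<^bsub>M\<^esub> p (act a x)"


section \<open>The dual algebra and the rational module\<close>

text \<open>Linear functionals are taken to be \<^const>\<open>undefined\<close> outside the carrier, so that they form
  a subspace of \<^const>\<open>ring.func_space\<close>.\<close>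

definition dual_algebra ::
  "('k, 'e) ring_scheme \<Rightarrow> ('k, 'c, 'f) module_scheme \<Rightarrow> ('c \<Rightarrow> ('c \<times> 'c \<Rightarrow> 'k) set) \<Rightarrow>
   ('k, 'c \<Rightarrow> 'k) module" where
  "dual_algebra K C \<Delta> = (ring.func_space K (carrier C))
     \<lparr>carrier := module_hom K C (self_space K) \<inter> extensional (carrier C),
      mult := (\<lambda>f g. \<lambda>c\<in>carrier C.
        tensor_lift K C C (self_space K) (\<lambda>a b. f a \<otimes>\<^bsub>K\<^esub> g b) (\<Delta> c))\<rparr>"

definition dual_op :: "('k, 'c, 'f) module_scheme \<Rightarrow> ('c \<Rightarrow> 'c) \<Rightarrow> ('c \<Rightarrow> 'k) \<Rightarrow> 'c \<Rightarrow> 'k" where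
  "dual_op C P f = (\<lambda>c\<in>carrier C. f (P c))"

definition rational_act ::
  "('k, 'e) ring_scheme \<Rightarrow> ('k, 'c, 'f) module_scheme \<Rightarrow> ('k, 'm, 'g) module_scheme \<Rightarrow>
   ('m \<Rightarrow> ('m \<times> 'c \<Rightarrow> 'k) set) \<Rightarrow> ('c \<Rightarrow> 'k) \<Rightarrow> 'm \<Rightarrow> 'm" where
  "rational_act K C M \<rho> f m = tensor_lift K M C M (\<lambda>x c. f c \<odot>\<^bsub>M\<^esub> x) (\<rho> m)"

end

theory Submission
  imports Defs
begin

text \<open>By the universal property of the tensor product, a bilinear map can be applied to both sides of
  an identity between tensors. Applied to the coassociativity laws this gives the associativity of the
  convolution product and of the rational action; applied to the Rota-Baxter identity of \<open>C\<close> it gives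
  that of \<open>C\<^sup>*\<close>. For the module identity, apply \<open>x \<otimes> c \<mapsto> a(c) x\<close> to the Rota-Baxter identity of
  \<open>\<rho>\<close> at \<open>x\<close>: it reads \<open>p (P\<^sup>*(a) x) = p (a p(x)) + P\<^sup>*(a) p(x) + \<lambda> a p(x)\<close>. Since a comodule
  morphism \<open>p\<close> commutes with the action of \<open>C\<^sup>*\<close>, the left-hand side is \<open>P\<^sup>*(a) p(x)\<close> and the last two
  terms are \<open>p (P\<^sup>*(a) x)\<close> and \<open>\<lambda> p (a x)\<close>.\<close>

section \<open>Linear maps\<close>

text \<open>The obstacle is that a tensor is a coset of finitely supported functions, and
  \<open>tensor_lift\<close> evaluates an arbitrarily chosen element of it. The choice is harmless
  because the sum formed from a bilinear map vanishes on the span of the relations. Once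
  \<open>tensor_lift_coset\<close> records this, the choice is never unfolded again, and equations
  between lifts reduce to pure tensors. A second friction: linear maps are constrained only on
  carriers, whereas elements of the dual are also extensional. Hence the restricted functionals and
  the congruence rules that compare maps on carriers only. The comodule identity has
  \<open>p\<close> of the action of \<open>dual_op C P a\<close> on \<open>x\<close> alone on one
  side, and that action on \<open>p x\<close> among the summands; the module identity has them the
  other way round. The morphism hypothesis permits the exchange.\<close>

lemma module_homI:
  assumes "\<And>x. x \<in> carrier M \<Longrightarrow> f x \<in> carrier N"
    and "\<And>x y. \<lbrakk>x \<in> carrier M; y \<in> carrier M\<rbrakk> \<Longrightarrow> f (x \<oplus>\<^bsub>M\<^esub> y) = f x \<oplus>\<^bsub>N\<^esub> f y"
    and "\<And>k x. \<lbrakk>k \<in> carrier R; x \<in> carrier M\<rbrakk> \<Longrightarrow> f (k \<odot>\<^bsub>M\<^esub> x) = k \<odot>\<^bsub>N\<^esub> f x"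
  shows "f \<in> module_hom R M N"
  using assms by (auto simp: module_hom_def)

lemma module_hom_in_carrier: "f \<in> module_hom R M N \<Longrightarrow> x \<in> carrier M \<Longrightarrow> f x \<in> carrier N"
  by (auto simp: module_hom_def)

lemma module_hom_zero:
  assumes "module R M" "module R N" "f \<in> module_hom R M N"
  shows "f \<zero>\<^bsub>M\<^esub> = \<zero>\<^bsub>N\<^esub>"
  using assms mod_hom.f0_is_0 by (metis mod_hom.intro mod_hom_axioms.intro)

text \<open>The Rota-Baxter identities for tensors have a right-hand side of this shape, so a lift
  crosses it in one step.\<close>

lemma module_hom_add_add_smult:
  assumes "module R M" "f \<in> module_hom R M N"
    and "x \<in> carrier M" "y \<in> carrier M" "z \<in> carrier M" "k \<in> carrier R"
  shows "f (x \<oplus>\<^bsub>M\<^esub> y \<oplus>\<^bsub>M\<^esub> k \<odot>\<^bsub>M\<^esub> z) = f x \<oplus>\<^bsub>N\<^esub> f y \<oplus>\<^bsub>N\<^esub> k \<odot>\<^bsub>N\<^esub> f z"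
proof -
  interpret M: module R M by fact
  show ?thesis using assms(3-) by (simp add: module_hom_add[OF assms(2)] module_hom_smult[OF assms(2)])
qed

lemma module_hom_minus:
  assumes "module R M" "module R N" "f \<in> module_hom R M N" "x \<in> carrier M" "y \<in> carrier M"
  shows "f (x \<ominus>\<^bsub>M\<^esub> y) = f x \<ominus>\<^bsub>N\<^esub> f y"
  using assms mod_hom.f_minus by (metis mod_hom.intro mod_hom_axioms.intro)

lemma module_hom_compose:
  "f \<in> module_hom R L M \<Longrightarrow> g \<in> module_hom R M N \<Longrightarrow> (\<lambda>x. g (f x)) \<in> module_hom R L N"
  by (auto simp: module_hom_def Pi_iff)

lemma module_hom_id: "(\<lambda>x. x) \<in> module_hom R M M"
  by (simp add: module_hom_def)

section \<open>Free modules and quotients\<close>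

lemma free_space_simps:
  assumes "ring R"
  shows "carrier (free_space R S) = {f \<in> S \<rightarrow>\<^sub>E carrier R. finite {s \<in> S. f s \<noteq> \<zero>\<^bsub>R\<^esub>}}"
    and "\<zero>\<^bsub>free_space R S\<^esub> = (\<lambda>s\<in>S. \<zero>\<^bsub>R\<^esub>)"
    and "f \<oplus>\<^bsub>free_space R S\<^esub> g = (\<lambda>s\<in>S. f s \<oplus>\<^bsub>R\<^esub> g s)"
    and "k \<odot>\<^bsub>free_space R S\<^esub> f = (\<lambda>s\<in>S. k \<otimes>\<^bsub>R\<^esub> f s)"
  by (simp_all add: free_space_def ring.func_space_def[OF assms])

lemma (in cring) module_free_space: "module R (free_space R S)"
proof -
  \<comment> \<open>Addition and scaling are pointwise, so the support of a result lies in the union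
    of the supports of the arguments.\<close>
  have fin: "finite {s \<in> S. h s \<noteq> \<zero>}"
    if "finite {s \<in> S. f s \<noteq> \<zero>}" "finite {s \<in> S. g s \<noteq> \<zero>}"
      "\<And>s. s \<in> S \<Longrightarrow> f s = \<zero> \<Longrightarrow> g s = \<zero> \<Longrightarrow> h s = \<zero>" for f g h :: "_ \<Rightarrow> 'a"
    by (rule finite_subset[of _ "{s \<in> S. f s \<noteq> \<zero>} \<union> {s \<in> S. g s \<noteq> \<zero>}"]) (use that in auto)
  interpret F: module R "func_space S" by (rule func_space_is_module)
  have "LinearCombinations.submodule R {f \<in> S \<rightarrow>\<^sub>E carrier R. finite {s \<in> S. f s \<noteq> \<zero>}} (func_space S)"
  proof
    show "{f \<in> S \<rightarrow>\<^sub>E carrier R. finite {s \<in> S. f s \<noteq> \<zero>}} \<subseteq> carrier (func_space S)"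
      by (auto simp: func_space_def)
    show "\<zero>\<^bsub>func_space S\<^esub> \<in> {f \<in> S \<rightarrow>\<^sub>E carrier R. finite {s \<in> S. f s \<noteq> \<zero>}}"
      by (auto simp: func_space_def)
  next
    fix v w
    assume "v \<in> {f \<in> S \<rightarrow>\<^sub>E carrier R. finite {s \<in> S. f s \<noteq> \<zero>}}"
      "w \<in> {f \<in> S \<rightarrow>\<^sub>E carrier R. finite {s \<in> S. f s \<noteq> \<zero>}}"
    then show "v \<oplus>\<^bsub>func_space S\<^esub> w \<in> {f \<in> S \<rightarrow>\<^sub>E carrier R. finite {s \<in> S. f s \<noteq> \<zero>}}"
      by (auto simp: func_space_def PiE_mem cong: conj_cong intro: fin[of v w])
  next
    fix c v assume "c \<in> carrier R" "v \<in> {f \<in> S \<rightarrow>\<^sub>E carrier R. finite {s \<in> S. f s \<noteq> \<zero>}}"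
    then show "c \<odot>\<^bsub>func_space S\<^esub> v \<in> {f \<in> S \<rightarrow>\<^sub>E carrier R. finite {s \<in> S. f s \<noteq> \<zero>}}"
      by (auto simp: func_space_def PiE_mem cong: conj_cong intro: fin[of v v])
  qed
  then show ?thesis
    unfolding free_space_def by (rule F.submodule_is_module)
qed

lemma (in cring) free_gen_closed:
  assumes "s \<in> S"
  shows "free_gen R S s \<in> carrier (free_space R S)"
proof -
  have "{t \<in> S. (if t = s then \<one> else \<zero>) \<noteq> \<zero>} \<subseteq> {s}" by auto
  then have "finite {t \<in> S. (if t = s then \<one> else \<zero>) \<noteq> \<zero>}" by (rule finite_subset) simp
  then show ?thesis
    by (auto simp: free_space_simps[OF ring_axioms] free_gen_def cong: conj_cong)
qed

text \<open>This is the sum in \<open>tensor_lift\<close> without the choice of a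
  representative.\<close>

definition free_lift ::
  "('k, 'e) ring_scheme \<Rightarrow> 's set \<Rightarrow> ('k, 'u, 'h) module_scheme \<Rightarrow> ('s \<Rightarrow> 'u) \<Rightarrow> ('s \<Rightarrow> 'k) \<Rightarrow> 'u" where
  "free_lift R S U b x = (\<Oplus>\<^bsub>U\<^esub>s\<in>{s \<in> S. x s \<noteq> \<zero>\<^bsub>R\<^esub>}. x s \<odot>\<^bsub>U\<^esub> b s)"

text \<open>Supports change under addition, since coefficients may cancel; padding with zero terms
  up to a common finite set makes the sums comparable.\<close>

lemma free_lift_eq_finsum:
  assumes "module R U" "b \<in> S \<rightarrow> carrier U" "x \<in> carrier (free_space R S)"
    and "finite A" "A \<subseteq> S" "{s \<in> S. x s \<noteq> \<zero>\<^bsub>R\<^esub>} \<subseteq> A"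
  shows "free_lift R S U b x = (\<Oplus>\<^bsub>U\<^esub>s\<in>A. x s \<odot>\<^bsub>U\<^esub> b s)"
proof -
  interpret U: module R U by fact
  have "x s \<in> carrier R" "b s \<in> carrier U" if "s \<in> A" for s
    using assms that by (auto simp: free_space_simps[OF U.R.ring_axioms])
  then show ?thesis
    unfolding free_lift_def
    by (intro U.add.finprod_mono_neutral_cong_left) (use assms in auto)
qed

lemma free_lift_hom:
  assumes "module R U" and b: "b \<in> S \<rightarrow> carrier U"
  shows "free_lift R S U b \<in> module_hom R (free_space R S) U"
proof -
  interpret U: module R U by fact
  interpret F: module R "free_space R S" by (rule U.R.module_free_space)
  note fs = free_space_simps[OF U.R.ring_axioms]
  let ?supp = "\<lambda>x. {s \<in> S. x s \<noteq> \<zero>\<^bsub>R\<^esub>}"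
  have bc: "b s \<in> carrier U" if "s \<in> S" for s using b that by auto
  have xc: "x s \<in> carrier R" if "x \<in> carrier (free_space R S)" "s \<in> S" for x s
    using that by (auto simp: fs)
  show ?thesis
  proof (rule module_homI)
    fix x assume "x \<in> carrier (free_space R S)"
    then show "free_lift R S U b x \<in> carrier U"
      unfolding free_lift_def using bc xc
      by (intro U.M.finsum_closed) auto
  next
    fix x y assume x: "x \<in> carrier (free_space R S)" and y: "y \<in> carrier (free_space R S)"
    let ?A = "?supp x \<union> ?supp y"
    have A: "finite ?A" "?A \<subseteq> S" using x y by (auto simp: fs)
    have "free_lift R S U b (x \<oplus>\<^bsub>free_space R S\<^esub> y)
      = (\<Oplus>\<^bsub>U\<^esub>s\<in>?A. (x \<oplus>\<^bsub>free_space R S\<^esub> y) s \<odot>\<^bsub>U\<^esub> b s)"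
      by (rule free_lift_eq_finsum) (use assms F.M.a_closed[OF x y] A in \<open>auto simp: fs(3)\<close>)
    also have "\<dots> = (\<Oplus>\<^bsub>U\<^esub>s\<in>?A. x s \<odot>\<^bsub>U\<^esub> b s \<oplus>\<^bsub>U\<^esub> y s \<odot>\<^bsub>U\<^esub> b s)"
      by (rule U.M.finsum_cong')
        (use bc xc[OF x] xc[OF y] in \<open>auto simp: fs U.smult_l_distr\<close>)
    also have "\<dots> = (\<Oplus>\<^bsub>U\<^esub>s\<in>?A. x s \<odot>\<^bsub>U\<^esub> b s) \<oplus>\<^bsub>U\<^esub> (\<Oplus>\<^bsub>U\<^esub>s\<in>?A. y s \<odot>\<^bsub>U\<^esub> b s)"
      by (rule U.M.finsum_addf) (use bc xc[OF x] xc[OF y] A in \<open>auto simp: Pi_iff\<close>)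
    also have "\<dots> = free_lift R S U b x \<oplus>\<^bsub>U\<^esub> free_lift R S U b y"
      using assms x y A by (auto simp: free_lift_eq_finsum[of R U b S _ ?A])
    finally show "free_lift R S U b (x \<oplus>\<^bsub>free_space R S\<^esub> y)
      = free_lift R S U b x \<oplus>\<^bsub>U\<^esub> free_lift R S U b y" .
  next
    fix k x assume k: "k \<in> carrier R" and x: "x \<in> carrier (free_space R S)"
    have A: "finite (?supp x)" using x by (auto simp: fs)
    have "free_lift R S U b (k \<odot>\<^bsub>free_space R S\<^esub> x)
      = (\<Oplus>\<^bsub>U\<^esub>s\<in>?supp x. (k \<odot>\<^bsub>free_space R S\<^esub> x) s \<odot>\<^bsub>U\<^esub> b s)"
      by (rule free_lift_eq_finsum) (use assms F.smult_closed[OF k x] k A in \<open>auto simp: fs(4)\<close>)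
    also have "\<dots> = (\<Oplus>\<^bsub>U\<^esub>s\<in>?supp x. k \<odot>\<^bsub>U\<^esub> (x s \<odot>\<^bsub>U\<^esub> b s))"
      by (rule U.M.finsum_cong')
        (use bc xc[OF x] k in \<open>auto simp: fs U.smult_assoc1\<close>)
    also have "\<dots> = k \<odot>\<^bsub>U\<^esub> free_lift R S U b x"
      unfolding free_lift_def
      by (rule U.finsum_smult_ldistr[symmetric]) (use bc xc[OF x] k A in \<open>auto simp: Pi_iff\<close>)
    finally show "free_lift R S U b (k \<odot>\<^bsub>free_space R S\<^esub> x) = k \<odot>\<^bsub>U\<^esub> free_lift R S U b x" .
  qed
qed

lemma free_lift_gen:
  assumes "module R U" "b \<in> S \<rightarrow> carrier U" "s \<in> S"
  shows "free_lift R S U b (free_gen R S s) = b s"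
proof -
  interpret U: module R U by fact
  have "b s \<in> carrier U" using assms by auto
  then show ?thesis
    using assms U.R.free_gen_closed[OF assms(3)]
    by (subst free_lift_eq_finsum[of R U b S _ "{s}"]) (auto simp: free_gen_def)
qed

text \<open>Every element is a finite combination of generators. The induction runs over a finite
  superset \<open>A\<close> of the support, with \<open>x\<close> arbitrary, so that erasing one
  coefficient leaves an instance for a smaller set.\<close>

lemma free_space_hom_ext:
  assumes "module R U" and g: "g \<in> module_hom R (free_space R S) U"
    and h: "h \<in> module_hom R (free_space R S) U"
    and eq: "\<And>s. s \<in> S \<Longrightarrow> g (free_gen R S s) = h (free_gen R S s)"
    and x: "x \<in> carrier (free_space R S)"
  shows "g x = h x"
proof -
  interpret U: module R U by fact
  interpret F: module R "free_space R S" by (rule U.R.module_free_space)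
  note fs = free_space_simps[OF U.R.ring_axioms]
  have "finite {s \<in> S. x s \<noteq> \<zero>\<^bsub>R\<^esub>}" using x by (simp add: fs)
  then obtain A where "finite A" "{s \<in> S. x s \<noteq> \<zero>\<^bsub>R\<^esub>} \<subseteq> A" by blast
  then show ?thesis using x
  proof (induction A arbitrary: x rule: finite_induct)
    case empty
    then have "x = \<zero>\<^bsub>free_space R S\<^esub>" by (auto simp: fs PiE_def extensional_def fun_eq_iff)
    then show ?case
      using module_hom_zero[OF F.module_axioms assms(1) g]
        module_hom_zero[OF F.module_axioms assms(1) h] by simp
  next
    case (insert a A)
    show ?case
    proof (cases "a \<in> S")
      case False
      then show ?thesis using insert by (intro insert.IH) auto
    next
      case True
      \<comment> \<open>\<open>?y\<close> is \<open>x\<close> with its coefficient at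
        \<open>a\<close> erased; the difference is \<open>x a\<close> times the generator at
        \<open>a\<close>.\<close>
      let ?y = "x(a := \<zero>\<^bsub>R\<^esub>)" and ?e = "free_gen R S a"
      have "{s \<in> S. ?y s \<noteq> \<zero>\<^bsub>R\<^esub>} \<subseteq> {s \<in> S. x s \<noteq> \<zero>\<^bsub>R\<^esub>}" by auto
      then have y: "?y \<in> carrier (free_space R S)"
        using insert.prems(2) True finite_subset
        unfolding fs PiE_def extensional_def by fastforce
      have e: "?e \<in> carrier (free_space R S)" using True by (rule U.R.free_gen_closed)
      have xa: "x a \<in> carrier R" using insert.prems(2) True by (auto simp: fs)
      have "x = ?y \<oplus>\<^bsub>free_space R S\<^esub> (x a \<odot>\<^bsub>free_space R S\<^esub> ?e)"
      proof
        fix s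
        show "x s = (?y \<oplus>\<^bsub>free_space R S\<^esub> (x a \<odot>\<^bsub>free_space R S\<^esub> ?e)) s"
        proof (cases "s \<in> S")
          case True
          then have "x s \<in> carrier R" using insert.prems(2) by (auto simp: fs)
          then show ?thesis using True xa by (simp add: fs free_gen_def)
        next
          case False
          then show ?thesis using insert.prems(2) by (auto simp: fs PiE_def extensional_def)
        qed
      qed
      moreover have "g ?y = h ?y"
        using insert.prems(1) by (intro insert.IH[OF _ y]) auto
      ultimately show ?thesis
        using module_hom_add[OF g y F.smult_closed[OF xa e]] module_hom_smult[OF g xa e]
          module_hom_add[OF h y F.smult_closed[OF xa e]] module_hom_smult[OF h xa e] eq[OF True]
        by simp
    qed
  qed
qed

text \<open>Each axiom is pulled back to preimages in \<open>V\<close>. This serves for the coset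
  projection and, with the identity map, for the dual algebra.\<close>

lemma module_surj_image:
  fixes Q (structure)
  assumes "module R V"
    and cl: "\<And>v. v \<in> carrier V \<Longrightarrow> \<pi> v \<in> carrier Q"
    and surj: "\<And>X. X \<in> carrier Q \<Longrightarrow> \<exists>v\<in>carrier V. X = \<pi> v"
    and zero: "\<pi> \<zero>\<^bsub>V\<^esub> = \<zero>"
    and add: "\<And>v w. \<lbrakk>v \<in> carrier V; w \<in> carrier V\<rbrakk> \<Longrightarrow> \<pi> v \<oplus> \<pi> w = \<pi> (v \<oplus>\<^bsub>V\<^esub> w)"
    and smult: "\<And>k v. \<lbrakk>k \<in> carrier R; v \<in> carrier V\<rbrakk> \<Longrightarrow> k \<odot> \<pi> v = \<pi> (k \<odot>\<^bsub>V\<^esub> v)"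
  shows "module R Q"
proof -
  interpret V: module R V by fact
  show ?thesis
  proof (rule moduleI)
    show "cring R" by unfold_locales
    show "abelian_group Q"
    proof (rule abelian_groupI)
      show "\<zero> \<in> carrier Q" using cl[OF V.M.zero_closed] zero by simp
    next
      fix X Y assume "X \<in> carrier Q" "Y \<in> carrier Q"
      then obtain v w where "v \<in> carrier V" "X = \<pi> v" "w \<in> carrier V" "Y = \<pi> w"
        using surj by blast
      then show "X \<oplus> Y \<in> carrier Q" "X \<oplus> Y = Y \<oplus> X"
        by (auto simp: add cl V.M.a_comm)
    next
      fix X Y Z assume "X \<in> carrier Q" "Y \<in> carrier Q" "Z \<in> carrier Q"
      then obtain u v w where "u \<in> carrier V" "v \<in> carrier V" "w \<in> carrier V"
        and "X = \<pi> u" "Y = \<pi> v" "Z = \<pi> w"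
        using surj by metis
      then show "X \<oplus> Y \<oplus> Z = X \<oplus> (Y \<oplus> Z)" by (simp add: add V.M.a_assoc)
    next
      fix X assume "X \<in> carrier Q"
      then obtain v where v: "v \<in> carrier V" "X = \<pi> v" using surj by blast
      then show "\<zero> \<oplus> X = X" by (auto simp: zero[symmetric] add)
      show "\<exists>Y\<in>carrier Q. Y \<oplus> X = \<zero>"
        using v by (intro bexI[of _ "\<pi> (\<ominus>\<^bsub>V\<^esub> v)"]) (auto simp: add cl zero V.M.l_neg)
    qed
  next
    fix k X assume k: "k \<in> carrier R" and "X \<in> carrier Q"
    then obtain v where v: "v \<in> carrier V" "X = \<pi> v" using surj by blast
    show "k \<odot> X \<in> carrier Q" using k v by (simp add: smult cl)
    fix l assume l: "l \<in> carrier R"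
    show "(k \<oplus>\<^bsub>R\<^esub> l) \<odot> X = k \<odot> X \<oplus> l \<odot> X" "(k \<otimes>\<^bsub>R\<^esub> l) \<odot> X = k \<odot> (l \<odot> X)"
      using k l v by (auto simp: smult add V.smult_l_distr V.smult_assoc1)
  next
    fix k X Y assume k: "k \<in> carrier R" and "X \<in> carrier Q" "Y \<in> carrier Q"
    then obtain v w where "v \<in> carrier V" "X = \<pi> v" "w \<in> carrier V" "Y = \<pi> w"
      using surj by blast
    then show "k \<odot> (X \<oplus> Y) = k \<odot> X \<oplus> k \<odot> Y" using k by (auto simp: smult add V.smult_r_distr)
  next
    fix X assume "X \<in> carrier Q"
    then obtain v where v: "v \<in> carrier V" "X = \<pi> v" using surj by blast
    then show "\<one>\<^bsub>R\<^esub> \<odot> X = X" by (simp add: smult)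
  qed
qed

section \<open>Quotients by a submodule\<close>

locale quotient_module = module R V for R V +
  fixes N
  assumes sub: "LinearCombinations.submodule R N V"
begin

lemma subgroup_sub: "abelian_subgroup N V"
proof -
  interpret N: LinearCombinations.submodule R N V by (rule sub)
  show ?thesis
  proof (rule abelian_subgroupI3)
    show "additive_subgroup N V"
    proof (rule additive_subgroupI, rule add.subgroupI)
      show "N \<subseteq> carrier V" by (rule N.subset)
      show "N \<noteq> {}" using N.zero_closed by blast
      fix a assume a: "a \<in> N"
      \<comment> \<open>Closure under negation comes from closure under multiplication by
        -1.\<close>
      then have "(\<ominus>\<^bsub>R\<^esub> \<one>\<^bsub>R\<^esub>) \<odot>\<^bsub>V\<^esub> a = \<ominus>\<^bsub>V\<^esub> a" using N.subset by (auto simp: smult_l_minus)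
      then show "\<ominus>\<^bsub>V\<^esub> a \<in> N" using a by (metis N.smult_closed R.a_inv_closed R.one_closed)
    next
      fix a b assume "a \<in> N" "b \<in> N" then show "a \<oplus>\<^bsub>V\<^esub> b \<in> N" by (rule N.m_closed)
    qed
  qed unfold_locales
qed

sublocale N: abelian_subgroup N V by (rule subgroup_sub)

text \<open>The scalar action on cosets is a union over all elements of the coset. Any two of them
  differ by an element of \<open>N\<close>, hence so do their multiples, and all cosets in the union
  coincide.\<close>

lemma smult_coset:
  assumes "k \<in> carrier R" "v \<in> carrier V"
  shows "k \<odot>\<^bsub>quot_space V N\<^esub> (N +>\<^bsub>V\<^esub> v) = N +>\<^bsub>V\<^esub> (k \<odot>\<^bsub>V\<^esub> v)"
proof -
  have "N +>\<^bsub>V\<^esub> (k \<odot>\<^bsub>V\<^esub> w) = N +>\<^bsub>V\<^esub> (k \<odot>\<^bsub>V\<^esub> v)" if "w \<in> N +>\<^bsub>V\<^esub> v" for w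
  proof -
    have w: "w \<in> carrier V" using that assms(2) by (rule N.a_elemrcos_carrier[rotated])
    have "w \<oplus>\<^bsub>V\<^esub> \<ominus>\<^bsub>V\<^esub> v \<in> N" using N.a_rcos_module_imp[OF assms(2) that] .
    then have "k \<odot>\<^bsub>V\<^esub> (w \<oplus>\<^bsub>V\<^esub> \<ominus>\<^bsub>V\<^esub> v) \<in> N"
      using assms(1) sub by (simp add: LinearCombinations.submodule.smult_closed)
    then have "k \<odot>\<^bsub>V\<^esub> w \<oplus>\<^bsub>V\<^esub> \<ominus>\<^bsub>V\<^esub> (k \<odot>\<^bsub>V\<^esub> v) \<in> N"
      using assms w by (simp add: smult_r_distr smult_r_minus)
    then have "k \<odot>\<^bsub>V\<^esub> w \<in> N +>\<^bsub>V\<^esub> (k \<odot>\<^bsub>V\<^esub> v)"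
      using assms w by (intro N.a_rcos_module_rev) auto
    then show ?thesis using assms by (metis N.a_repr_independence' smult_closed)
  qed
  moreover have "v \<in> N +>\<^bsub>V\<^esub> v" using assms(2) by (rule N.a_rcos_self)
  ultimately have "(\<Union>w\<in>N +>\<^bsub>V\<^esub> v. N +>\<^bsub>V\<^esub> (k \<odot>\<^bsub>V\<^esub> w)) = N +>\<^bsub>V\<^esub> (k \<odot>\<^bsub>V\<^esub> v)"
    by blast
  then show ?thesis by (simp add: quot_space_def)
qed

lemma coset_closed: "v \<in> carrier V \<Longrightarrow> N +>\<^bsub>V\<^esub> v \<in> carrier (quot_space V N)"
  by (simp add: quot_space_def a_rcosetsI N.a_subset)

lemma coset_cases:
  assumes "X \<in> carrier (quot_space V N)"
  obtains v where "v \<in> carrier V" "X = N +>\<^bsub>V\<^esub> v"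
  using assms by (auto simp: quot_space_def A_RCOSETS_def')

lemma coset_eqI:
  assumes "v \<in> carrier V" "w \<in> carrier V" "v \<ominus>\<^bsub>V\<^esub> w \<in> N"
  shows "N +>\<^bsub>V\<^esub> v = N +>\<^bsub>V\<^esub> w"
proof -
  have "v \<in> N +>\<^bsub>V\<^esub> w" using assms by (intro N.a_rcos_module_rev) (simp_all add: a_minus_def)
  then show ?thesis using assms(2) by (metis N.a_repr_independence')
qed

lemma coset_hom: "(\<lambda>v. N +>\<^bsub>V\<^esub> v) \<in> module_hom R V (quot_space V N)"
  by (rule module_homI) (simp_all add: coset_closed smult_coset, simp add: quot_space_def N.a_rcos_sum)

lemma module_quot_space: "module R (quot_space V N)"
proof (rule module_surj_image[of R V "\<lambda>v. N +>\<^bsub>V\<^esub> v"])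
  show "\<exists>v\<in>carrier V. X = N +>\<^bsub>V\<^esub> v" if "X \<in> carrier (quot_space V N)" for X
    using that by (rule coset_cases) blast
qed (simp_all add: module_axioms coset_closed smult_coset,
    simp_all add: quot_space_def N.a_rcos_sum N.a_rcos_const)

text \<open>Two elements of a coset differ by an element of \<open>N\<close>, which \<open>f\<close>
  kills. This is what makes the choice in \<open>tensor_lift\<close> harmless.\<close>

lemma coset_rep_hom:
  assumes "module R U" "f \<in> module_hom R V U" "\<And>n. n \<in> N \<Longrightarrow> f n = \<zero>\<^bsub>U\<^esub>"
    and v: "v \<in> carrier V" and w: "w \<in> N +>\<^bsub>V\<^esub> v"
  shows "f w = f v"
proof -
  interpret U: module R U by fact
  have wV: "w \<in> carrier V" using v w by (rule N.a_elemrcos_carrier)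
  have "f (w \<ominus>\<^bsub>V\<^esub> v) = \<zero>\<^bsub>U\<^esub>"
    using N.a_rcos_module_imp[OF v w] by (simp add: assms(3) a_minus_def)
  then have "f w \<ominus>\<^bsub>U\<^esub> f v = \<zero>\<^bsub>U\<^esub>"
    using module_hom_minus[OF module_axioms assms(1,2) wV v] by simp
  moreover have "f w \<in> carrier U" "f v \<in> carrier U"
    using module_hom_in_carrier[OF assms(2)] v wV by auto
  ultimately show ?thesis
    using U.M.minus_equality[of "f w" "\<ominus>\<^bsub>U\<^esub> f v"] by (simp add: a_minus_def)
qed

end

section \<open>The universal property of the tensor product\<close>

lemma module_hom_sum:
  assumes "module K U" "f \<in> module_hom K V U" "g \<in> module_hom K V U"
  shows "(\<lambda>v. f v \<oplus>\<^bsub>U\<^esub> g v) \<in> module_hom K V U"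
proof -
  interpret U: module K U by fact
  note fg = module_hom_in_carrier[OF assms(2)] module_hom_in_carrier[OF assms(3)]
  show ?thesis
    by (rule module_homI)
      (simp_all add: fg module_hom_add[OF assms(2)] module_hom_add[OF assms(3)]
        module_hom_smult[OF assms(2)] module_hom_smult[OF assms(3)] U.M.a_ac U.smult_r_distr)
qed

lemma module_hom_scaled:
  assumes "module K U" "f \<in> module_hom K V U" "k \<in> carrier K"
  shows "(\<lambda>v. k \<odot>\<^bsub>U\<^esub> f v) \<in> module_hom K V U"
proof -
  interpret U: module K U by fact
  have "k \<odot>\<^bsub>U\<^esub> (l \<odot>\<^bsub>U\<^esub> x) = l \<odot>\<^bsub>U\<^esub> (k \<odot>\<^bsub>U\<^esub> x)" if "l \<in> carrier K" "x \<in> carrier U" for l x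
    using that assms(3) by (metis U.R.m_comm U.smult_assoc1)
  then show ?thesis using assms(3)
    by (intro module_homI)
      (simp_all add: module_hom_in_carrier[OF assms(2)] module_hom_add[OF assms(2)]
        module_hom_smult[OF assms(2)] U.smult_r_distr)
qed

section \<open>Bilinear maps\<close>

definition bilinear_map ::
  "('k, 'e) ring_scheme \<Rightarrow> ('k, 'v, 'f) module_scheme \<Rightarrow> ('k, 'w, 'g) module_scheme \<Rightarrow>
   ('k, 'u, 'h) module_scheme \<Rightarrow> ('v \<Rightarrow> 'w \<Rightarrow> 'u) \<Rightarrow> bool" where
  "bilinear_map K V W U b \<longleftrightarrow> (\<forall>w\<in>carrier W. (\<lambda>v. b v w) \<in> module_hom K V U) \<and>
     (\<forall>v\<in>carrier V. b v \<in> module_hom K W U)"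

lemma bilinear_mapI:
  assumes "\<And>w. w \<in> carrier W \<Longrightarrow> (\<lambda>v. b v w) \<in> module_hom K V U"
    and "\<And>v. v \<in> carrier V \<Longrightarrow> b v \<in> module_hom K W U"
  shows "bilinear_map K V W U b"
  using assms by (simp add: bilinear_map_def)

lemma bilinear_mapD:
  assumes "bilinear_map K V W U b"
  shows "w \<in> carrier W \<Longrightarrow> (\<lambda>v. b v w) \<in> module_hom K V U"
    and "v \<in> carrier V \<Longrightarrow> b v \<in> module_hom K W U"
    and "v \<in> carrier V \<Longrightarrow> w \<in> carrier W \<Longrightarrow> b v w \<in> carrier U"
  using assms by (auto simp: bilinear_map_def dest: module_hom_in_carrier)

lemma bilinear_map_precompose:
  assumes "bilinear_map K V' W' U b" "f \<in> module_hom K V V'" "g \<in> module_hom K W W'"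
  shows "bilinear_map K V W U (\<lambda>v w. b (f v) (g w))"
  using assms
  by (auto intro!: bilinear_mapI module_hom_compose[OF assms(2)] module_hom_compose[OF assms(3)]
      dest: bilinear_mapD module_hom_in_carrier)

lemma bilinear_map_postcompose:
  assumes "bilinear_map K V W U b" "h \<in> module_hom K U U'"
  shows "bilinear_map K V W U' (\<lambda>v w. h (b v w))"
  using assms by (auto intro!: bilinear_mapI module_hom_compose[OF _ assms(2)] dest: bilinear_mapD)

locale tensor_space = V: module K V + W: module K W
  for K :: "('k, 'e) ring_scheme"
    and V :: "('k, 'v, 'f) module_scheme"
    and W :: "('k, 'w, 'g) module_scheme"
begin

abbreviation "S \<equiv> carrier V \<times> carrier W"
abbreviation "F \<equiv> free_space K S"
abbreviation "gen v w \<equiv> free_gen K S (v, w)"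

lemma gen_closed: "v \<in> carrier V \<Longrightarrow> w \<in> carrier W \<Longrightarrow> gen v w \<in> carrier F"
  by (simp add: V.R.free_gen_closed)

lemma tensor_rels_closed: "tensor_rels K V W \<subseteq> carrier F"
proof -
  interpret F: module K F by (rule V.R.module_free_space)
  show ?thesis by (auto simp: tensor_rels_def Let_def gen_closed intro!: F.M.minus_closed F.M.a_closed)
qed

sublocale T: quotient_module K F "tensor_null K V W"
proof -
  interpret F: module K F by (rule V.R.module_free_space)
  show "quotient_module K F (tensor_null K V W)"
    unfolding tensor_null_def using F.span_is_submodule[OF tensor_rels_closed] F.module_axioms
    by (simp add: quotient_module_def quotient_module_axioms_def)
qed

lemma rels_in_null: "x \<in> tensor_rels K V W \<Longrightarrow> x \<in> tensor_null K V W"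
  unfolding tensor_null_def using T.in_own_span[OF tensor_rels_closed] by blast

lemma module_tensor: "module K (tensor K V W)"
  by (simp add: tensor_def T.module_quot_space)

lemma null_coset_hom: "(\<lambda>x. tensor_null K V W +>\<^bsub>F\<^esub> x) \<in> module_hom K F (tensor K V W)"
  by (simp only: tensor_def T.coset_hom)

lemma pure_closed: "v \<in> carrier V \<Longrightarrow> w \<in> carrier W \<Longrightarrow> pure_tensor K V W v w \<in> carrier (tensor K V W)"
  by (simp add: pure_tensor_def tensor_def T.coset_closed gen_closed)

text \<open>Each of the four laws matches one of the four families in \<open>tensor_rels\<close>:
  its two sides differ by a relation, and relations lie in the submodule that is factored
  out.\<close>

lemma bilinear_pure: "bilinear_map K V W (tensor K V W) (pure_tensor K V W)"
proof (rule bilinear_mapI; rule module_homI)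
  \<comment> \<open>Read from right to left, so that a combination of cosets becomes the coset of a
    combination and \<open>T.coset_eqI\<close> applies.\<close>
  note hom = module_hom_add[OF null_coset_hom, symmetric] module_hom_smult[OF null_coset_hom, symmetric]
  fix w assume w: "w \<in> carrier W"
  {
    fix v v' assume v: "v \<in> carrier V" "v' \<in> carrier V"
    have "gen (v \<oplus>\<^bsub>V\<^esub> v') w \<ominus>\<^bsub>F\<^esub> (gen v w \<oplus>\<^bsub>F\<^esub> gen v' w) \<in> tensor_null K V W"
      using v w unfolding tensor_rels_def Let_def by (intro rels_in_null[unfolded tensor_rels_def Let_def]) blast
    then show "pure_tensor K V W (v \<oplus>\<^bsub>V\<^esub> v') w =
        pure_tensor K V W v w \<oplus>\<^bsub>tensor K V W\<^esub> pure_tensor K V W v' w"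
      using v w by (simp add: pure_tensor_def gen_closed hom T.coset_eqI)
  next
    fix k v assume v: "k \<in> carrier K" "v \<in> carrier V"
    have "gen (k \<odot>\<^bsub>V\<^esub> v) w \<ominus>\<^bsub>F\<^esub> (k \<odot>\<^bsub>F\<^esub> gen v w) \<in> tensor_null K V W"
      using v w unfolding tensor_rels_def Let_def by (intro rels_in_null[unfolded tensor_rels_def Let_def]) blast
    then show "pure_tensor K V W (k \<odot>\<^bsub>V\<^esub> v) w = k \<odot>\<^bsub>tensor K V W\<^esub> pure_tensor K V W v w"
      using v w by (simp add: pure_tensor_def gen_closed hom T.coset_eqI)
  }
next
  note hom = module_hom_add[OF null_coset_hom, symmetric] module_hom_smult[OF null_coset_hom, symmetric]
  fix v assume v: "v \<in> carrier V"
  {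
    fix w w' assume w: "w \<in> carrier W" "w' \<in> carrier W"
    have "gen v (w \<oplus>\<^bsub>W\<^esub> w') \<ominus>\<^bsub>F\<^esub> (gen v w \<oplus>\<^bsub>F\<^esub> gen v w') \<in> tensor_null K V W"
      using v w unfolding tensor_rels_def Let_def by (intro rels_in_null[unfolded tensor_rels_def Let_def]) blast
    then show "pure_tensor K V W v (w \<oplus>\<^bsub>W\<^esub> w') =
        pure_tensor K V W v w \<oplus>\<^bsub>tensor K V W\<^esub> pure_tensor K V W v w'"
      using v w by (simp add: pure_tensor_def gen_closed hom T.coset_eqI)
  next
    fix k w assume w: "k \<in> carrier K" "w \<in> carrier W"
    have "gen v (k \<odot>\<^bsub>W\<^esub> w) \<ominus>\<^bsub>F\<^esub> (k \<odot>\<^bsub>F\<^esub> gen v w) \<in> tensor_null K V W"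
      using v w unfolding tensor_rels_def Let_def by (intro rels_in_null[unfolded tensor_rels_def Let_def]) blast
    then show "pure_tensor K V W v (k \<odot>\<^bsub>W\<^esub> w) = k \<odot>\<^bsub>tensor K V W\<^esub> pure_tensor K V W v w"
      using v w by (simp add: pure_tensor_def gen_closed hom T.coset_eqI)
  }
qed (auto intro: pure_closed)

text \<open>Composed with the coset projection, \<open>g\<close> and \<open>h\<close> become linear
  maps on the free module that agree on generators.\<close>

lemma tensor_hom_ext:
  assumes "module K U" and g: "g \<in> module_hom K (tensor K V W) U"
    and h: "h \<in> module_hom K (tensor K V W) U"
    and eq: "\<And>v w. \<lbrakk>v \<in> carrier V; w \<in> carrier W\<rbrakk> \<Longrightarrow>
      g (pure_tensor K V W v w) = h (pure_tensor K V W v w)"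
    and X: "X \<in> carrier (tensor K V W)"
  shows "g X = h X"
proof -
  obtain x where x: "x \<in> carrier F" "X = tensor_null K V W +>\<^bsub>F\<^esub> x"
    using X unfolding tensor_def by (rule T.coset_cases)
  show ?thesis
    unfolding x(2)
    by (rule free_space_hom_ext[OF \<open>module K U\<close> module_hom_compose[OF null_coset_hom g]
          module_hom_compose[OF null_coset_hom h] _ x(1)])
      (use eq in \<open>auto simp: pure_tensor_def\<close>)
qed

text \<open>The kernel of the free lift is a submodule, so it contains the span of the relations as
  soon as it contains each relation; bilinearity gives the latter.\<close>

lemma free_lift_null:
  assumes U: "module K U" and b: "bilinear_map K V W U b" and n: "n \<in> tensor_null K V W"
  shows "free_lift K S U (\<lambda>s. b (fst s) (snd s)) n = \<zero>\<^bsub>U\<^esub>"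
proof -
  interpret U: module K U by fact
  let ?f = "free_lift K S U (\<lambda>s. b (fst s) (snd s))"
  have bS: "(\<lambda>s. b (fst s) (snd s)) \<in> S \<rightarrow> carrier U" using bilinear_mapD(3)[OF b] by auto
  have f: "?f \<in> module_hom K F U" by (rule free_lift_hom[OF U bS])
  have gen: "?f (gen v w) = b v w" if "v \<in> carrier V" "w \<in> carrier W" for v w
    using free_lift_gen[OF U bS, of "(v, w)"] that by simp
  interpret f: mod_hom K F U ?f by unfold_locales (rule f)
  have "tensor_rels K V W \<subseteq> f.ker"
  proof
    fix r assume r: "r \<in> tensor_rels K V W"
    \<comment> \<open>Every relation is a difference whose two members have the same image
      \<open>u\<close>.\<close>
    have r0: "?f (x \<ominus>\<^bsub>F\<^esub> y) = \<zero>\<^bsub>U\<^esub>"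
      if "x \<in> carrier F" "y \<in> carrier F" "?f x = u" "?f y = u" for x y u
      using that f.f_im[of x] by (simp add: a_minus_def U.M.r_neg)
    have "?f r = \<zero>\<^bsub>U\<^esub>"
      using r unfolding tensor_rels_def Let_def
      by (auto intro!: r0 simp: gen gen_closed module_hom_add[OF bilinear_mapD(1)[OF b]]
          module_hom_add[OF bilinear_mapD(2)[OF b]] module_hom_smult[OF bilinear_mapD(1)[OF b]]
          module_hom_smult[OF bilinear_mapD(2)[OF b]])
    then show "r \<in> f.ker" using r tensor_rels_closed by (auto simp: f.ker_def)
  qed
  then have "tensor_null K V W \<subseteq> f.ker"
    unfolding tensor_null_def by (rule T.span_is_subset[OF _ f.ker_is_submodule])
  then show ?thesis using n by (auto simp: f.ker_def)
qed

text \<open>The only point where the chosen representative is opened up: it lies in the same coset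
  as \<open>x\<close>, and the free lift is constant there.\<close>

lemma tensor_lift_coset:
  assumes U: "module K U" and b: "bilinear_map K V W U b" and x: "x \<in> carrier F"
  shows "tensor_lift K V W U b (tensor_null K V W +>\<^bsub>F\<^esub> x) =
    free_lift K S U (\<lambda>s. b (fst s) (snd s)) x"
proof -
  let ?X = "tensor_null K V W +>\<^bsub>F\<^esub> x"
  have bS: "(\<lambda>s. b (fst s) (snd s)) \<in> S \<rightarrow> carrier U" using bilinear_mapD(3)[OF b] by auto
  have "x \<in> ?X" using x by (rule T.N.a_rcos_self)
  then have "(SOME x. x \<in> ?X) \<in> ?X" by (rule someI[of "\<lambda>y. y \<in> ?X"])
  from T.coset_rep_hom[OF U free_lift_hom[OF U bS] free_lift_null[OF U b] x this]
  show ?thesis by (simp add: tensor_lift_def free_lift_def)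
qed

lemma tensor_lift_hom:
  assumes "module K U" "bilinear_map K V W U b"
  shows "tensor_lift K V W U b \<in> module_hom K (tensor K V W) U"
proof -
  interpret F: module K F by (rule V.R.module_free_space)
  have f: "free_lift K S U (\<lambda>s. b (fst s) (snd s)) \<in> module_hom K F U"
    using bilinear_mapD(3)[OF assms(2)] by (intro free_lift_hom[OF assms(1)]) auto
  note hom = module_hom_add[OF null_coset_hom, symmetric] module_hom_smult[OF null_coset_hom, symmetric]
  \<comment> \<open>Elimination rule that replaces every tensor by a coset, on which the lift is
    computed by the free lift.\<close>
  have cs: thesis if "X \<in> carrier (tensor K V W)"
      "\<And>x. x \<in> carrier F \<Longrightarrow> X = tensor_null K V W +>\<^bsub>F\<^esub> x \<Longrightarrow> thesis" for X thesis
    using that unfolding tensor_def by (rule T.coset_cases)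
  show ?thesis
    by (rule module_homI; (elim cs)?)
      (simp_all add: hom tensor_lift_coset[OF assms] module_hom_in_carrier[OF f] module_hom_add[OF f]
        module_hom_smult[OF f])
qed

lemma tensor_lift_closed:
  "\<lbrakk>module K U; bilinear_map K V W U b; X \<in> carrier (tensor K V W)\<rbrakk> \<Longrightarrow>
    tensor_lift K V W U b X \<in> carrier U"
  by (rule module_hom_in_carrier[OF tensor_lift_hom])

lemma tensor_lift_pure:
  assumes "module K U" "bilinear_map K V W U b" "v \<in> carrier V" "w \<in> carrier W"
  shows "tensor_lift K V W U b (pure_tensor K V W v w) = b v w"
proof -
  have "(\<lambda>s. b (fst s) (snd s)) \<in> S \<rightarrow> carrier U" using bilinear_mapD(3)[OF assms(2)] by auto
  from free_lift_gen[OF assms(1) this, of "(v, w)"] show ?thesis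
    using assms by (simp add: pure_tensor_def tensor_lift_coset gen_closed)
qed

lemma tensor_lift_unique:
  assumes "module K U" "h \<in> module_hom K (tensor K V W) U" "bilinear_map K V W U b"
    and "\<And>v w. \<lbrakk>v \<in> carrier V; w \<in> carrier W\<rbrakk> \<Longrightarrow> h (pure_tensor K V W v w) = b v w"
    and "X \<in> carrier (tensor K V W)"
  shows "h X = tensor_lift K V W U b X"
  by (rule tensor_hom_ext[OF assms(1,2) tensor_lift_hom[OF assms(1,3)] _ assms(5)])
    (simp add: assms tensor_lift_pure)

lemma bilinear_map_cong:
  assumes b: "bilinear_map K V W U b"
    and eq: "\<And>v w. \<lbrakk>v \<in> carrier V; w \<in> carrier W\<rbrakk> \<Longrightarrow> b' v w = b v w"
  shows "bilinear_map K V W U b'"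
  by (rule bilinear_mapI; rule module_homI)
    (simp_all add: eq bilinear_mapD(3)[OF b]
      module_hom_add[OF bilinear_mapD(1)[OF b]] module_hom_add[OF bilinear_mapD(2)[OF b]]
      module_hom_smult[OF bilinear_mapD(1)[OF b]] module_hom_smult[OF bilinear_mapD(2)[OF b]])

text \<open>Needed because \<open>restrict\<close> and \<open>dual_op\<close> alter functionals
  outside the carrier. The map \<open>b'\<close> inherits bilinearity from \<open>b\<close>.\<close>

lemma tensor_lift_cong:
  assumes "module K U" "bilinear_map K V W U b"
    and "\<And>v w. \<lbrakk>v \<in> carrier V; w \<in> carrier W\<rbrakk> \<Longrightarrow> b v w = b' v w"
    and "X \<in> carrier (tensor K V W)"
  shows "tensor_lift K V W U b X = tensor_lift K V W U b' X"
proof -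
  have "bilinear_map K V W U b'" using assms(3) by (intro bilinear_map_cong[OF assms(2)]) simp
  from tensor_lift_unique[OF assms(1) tensor_lift_hom[OF assms(1,2)] this _ assms(4)] show ?thesis
    by (simp add: assms tensor_lift_pure)
qed

lemma hom_tensor_lift:
  assumes "module K U" "module K U'" "bilinear_map K V W U b" "h \<in> module_hom K U U'"
    and "X \<in> carrier (tensor K V W)"
  shows "h (tensor_lift K V W U b X) = tensor_lift K V W U' (\<lambda>v w. h (b v w)) X"
  by (rule tensor_lift_unique[OF assms(2) module_hom_compose[OF tensor_lift_hom[OF assms(1,3)] assms(4)]
        bilinear_map_postcompose[OF assms(3,4)] _ assms(5)])
    (simp add: assms tensor_lift_pure)

text \<open>Both sides of each linearity law are linear in the tensor and agree on pure tensors. The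
  result makes iterated lifts bilinear and the rational action linear in the functional.\<close>

lemma tensor_lift_parameter_hom:
  assumes U: "module K U" and A: "module K A"
    and b: "\<And>a. a \<in> carrier A \<Longrightarrow> bilinear_map K V W U (b a)"
    and a: "\<And>v w. \<lbrakk>v \<in> carrier V; w \<in> carrier W\<rbrakk> \<Longrightarrow> (\<lambda>a. b a v w) \<in> module_hom K A U"
    and X: "X \<in> carrier (tensor K V W)"
  shows "(\<lambda>a. tensor_lift K V W U (b a) X) \<in> module_hom K A U"
proof (rule module_homI)
  interpret A: module K A by fact
  fix x assume x: "x \<in> carrier A"
  show "tensor_lift K V W U (b x) X \<in> carrier U" using x by (simp add: tensor_lift_closed U b X)
  {
    fix y assume y: "y \<in> carrier A"
    show "tensor_lift K V W U (b (x \<oplus>\<^bsub>A\<^esub> y)) X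
      = tensor_lift K V W U (b x) X \<oplus>\<^bsub>U\<^esub> tensor_lift K V W U (b y) X"
      using x y by (intro tensor_lift_unique[symmetric] module_hom_sum tensor_lift_hom)
        (simp_all add: U b X tensor_lift_pure module_hom_add[OF a])
  next
    fix k assume k: "k \<in> carrier K"
    show "tensor_lift K V W U (b (k \<odot>\<^bsub>A\<^esub> x)) X = k \<odot>\<^bsub>U\<^esub> tensor_lift K V W U (b x) X"
      using x k by (intro tensor_lift_unique[symmetric] module_hom_scaled tensor_lift_hom)
        (simp_all add: U b X tensor_lift_pure module_hom_smult[OF a])
  }
qed

end

section \<open>Tensor products of maps and associativity\<close>

locale tensor_map_space = A: tensor_space K V W + B: tensor_space K V' W'
  for K :: "('k, 'e) ring_scheme"
    and V :: "('k, 'v, 'f) module_scheme" and W :: "('k, 'w, 'g) module_scheme"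
    and V' :: "('k, 'x, 'h) module_scheme" and W' :: "('k, 'y, 'i) module_scheme" +
  fixes f g
  assumes f: "f \<in> module_hom K V V'" and g: "g \<in> module_hom K W W'"
begin

lemma bilinear_pure_map: "bilinear_map K V W (tensor K V' W') (\<lambda>v w. pure_tensor K V' W' (f v) (g w))"
  by (rule bilinear_map_precompose[OF B.bilinear_pure f g])

lemma tensor_map_hom: "tensor_map K V W V' W' f g \<in> module_hom K (tensor K V W) (tensor K V' W')"
  unfolding tensor_map_def by (rule A.tensor_lift_hom[OF B.module_tensor bilinear_pure_map])

text \<open>The composite is linear and sends v \<otimes> w to \<open>b (f v) (g w)\<close>. Through
  this rule an identity stated with \<open>tensor_map\<close> becomes a Sweedler sum.\<close>

lemma tensor_lift_map:
  assumes "module K U" "bilinear_map K V' W' U b" "X \<in> carrier (tensor K V W)"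
  shows "tensor_lift K V' W' U b (tensor_map K V W V' W' f g X) =
    tensor_lift K V W U (\<lambda>v w. b (f v) (g w)) X"
proof -
  have "tensor_lift K V' W' U b (tensor_map K V W V' W' f g X) =
    tensor_lift K V W U (\<lambda>v w. tensor_lift K V' W' U b (pure_tensor K V' W' (f v) (g w))) X"
    unfolding tensor_map_def
    by (rule A.hom_tensor_lift[OF B.module_tensor assms(1) bilinear_pure_map
          B.tensor_lift_hom[OF assms(1,2)] assms(3)])
  also have "\<dots> = tensor_lift K V W U (\<lambda>v w. b (f v) (g w)) X"
    by (rule A.tensor_lift_cong[OF assms(1) bilinear_map_postcompose[OF bilinear_pure_map
          B.tensor_lift_hom[OF assms(1,2)]] _ assms(3)])
      (simp add: B.tensor_lift_pure assms module_hom_in_carrier[OF f] module_hom_in_carrier[OF g])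
  finally show ?thesis .
qed

end

text \<open>The two clauses together give linearity in each of the three arguments, in the form that
  the two bracketings of an iterated lift require.\<close>

definition trilinear_map ::
  "('k, 'e) ring_scheme \<Rightarrow> ('k, 'u, 'f) module_scheme \<Rightarrow> ('k, 'v, 'g) module_scheme \<Rightarrow>
   ('k, 'w, 'h) module_scheme \<Rightarrow> ('k, 'z, 'i) module_scheme \<Rightarrow> ('u \<Rightarrow> 'v \<Rightarrow> 'w \<Rightarrow> 'z) \<Rightarrow> bool" where
  "trilinear_map K U V W Z t \<longleftrightarrow> (\<forall>u\<in>carrier U. bilinear_map K V W Z (t u)) \<and>
     (\<forall>w\<in>carrier W. bilinear_map K U V Z (\<lambda>u v. t u v w))"

lemma trilinear_mapI:
  assumes "\<And>u. u \<in> carrier U \<Longrightarrow> bilinear_map K V W Z (t u)"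
    and "\<And>w. w \<in> carrier W \<Longrightarrow> bilinear_map K U V Z (\<lambda>u v. t u v w)"
  shows "trilinear_map K U V W Z t"
  using assms by (simp add: trilinear_map_def)

lemma trilinear_mapD:
  assumes "trilinear_map K U V W Z t"
  shows "u \<in> carrier U \<Longrightarrow> bilinear_map K V W Z (t u)"
    and "w \<in> carrier W \<Longrightarrow> bilinear_map K U V Z (\<lambda>u v. t u v w)"
  using assms by (auto simp: trilinear_map_def)

lemma bilinear_tensor_lift_right:
  assumes "module K U" "tensor_space K V W" "module K Z" and t: "trilinear_map K U V W Z t"
  shows "bilinear_map K U (tensor K V W) Z (\<lambda>u. tensor_lift K V W Z (t u))"
proof (rule bilinear_mapI)
  interpret VW: tensor_space K V W by fact
  note t1 = trilinear_mapD(1)[OF t] and t2 = trilinear_mapD(2)[OF t]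
  show "(\<lambda>u. tensor_lift K V W Z (t u) X) \<in> module_hom K U Z" if "X \<in> carrier (tensor K V W)" for X
    by (rule VW.tensor_lift_parameter_hom[OF assms(3,1) t1 bilinear_mapD(1)[OF t2] that])
  show "tensor_lift K V W Z (t u) \<in> module_hom K (tensor K V W) Z" if "u \<in> carrier U" for u
    by (rule VW.tensor_lift_hom[OF assms(3) t1[OF that]])
qed

lemma bilinear_tensor_lift_left:
  assumes "tensor_space K U V" "module K W" "module K Z" and t: "trilinear_map K U V W Z t"
  shows "bilinear_map K (tensor K U V) W Z (\<lambda>X w. tensor_lift K U V Z (\<lambda>u v. t u v w) X)"
proof (rule bilinear_mapI)
  interpret UV: tensor_space K U V by fact
  note t1 = trilinear_mapD(1)[OF t] and t2 = trilinear_mapD(2)[OF t]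
  show "(\<lambda>w. tensor_lift K U V Z (\<lambda>u v. t u v w) X) \<in> module_hom K W Z"
    if "X \<in> carrier (tensor K U V)" for X
    by (rule UV.tensor_lift_parameter_hom[OF assms(3,2) t2 bilinear_mapD(2)[OF t1] that])
  show "tensor_lift K U V Z (\<lambda>u v. t u v w) \<in> module_hom K (tensor K U V) Z" if "w \<in> carrier W" for w
    by (rule UV.tensor_lift_hom[OF assms(3) t2[OF that]])
qed

locale triple_tensor_space = UV: tensor_space K U V + VW: tensor_space K V W
  for K :: "('k, 'e) ring_scheme"
    and U :: "('k, 'u, 'f) module_scheme"
    and V :: "('k, 'v, 'g) module_scheme"
    and W :: "('k, 'w, 'h) module_scheme"
begin

sublocale UV_W: tensor_space K "tensor K U V" W
  by (intro tensor_space.intro UV.module_tensor VW.W.module_axioms)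

sublocale U_VW: tensor_space K U "tensor K V W"
  by (intro tensor_space.intro VW.module_tensor UV.V.module_axioms)

lemma trilinear_pure:
  "trilinear_map K U V W (tensor K (tensor K U V) W)
    (\<lambda>u v w. pure_tensor K (tensor K U V) W (pure_tensor K U V u v) w)"
  by (rule trilinear_mapI)
    (auto intro: bilinear_map_precompose[OF UV_W.bilinear_pure _ module_hom_id]
      bilinear_map_postcompose[OF UV.bilinear_pure] bilinear_mapD(1)[OF UV_W.bilinear_pure]
      bilinear_mapD(2)[OF UV.bilinear_pure])

text \<open>The associator carries one bracketing of the lift of \<open>t\<close> to the other.
  Since \<open>tensor_assoc\<close> is itself an iterated lift of pure tensors, the outer lift can
  be pushed inside it, and the rest is checked on pure tensors.\<close>

lemma tensor_lift_assoc:
  assumes Z: "module K Z" and t: "trilinear_map K U V W Z t"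
    and Y: "Y \<in> carrier (tensor K U (tensor K V W))"
  shows "tensor_lift K (tensor K U V) W Z (\<lambda>X w. tensor_lift K U V Z (\<lambda>u v. t u v w) X)
      (tensor_assoc K U V W Y) =
    tensor_lift K U (tensor K V W) Z (\<lambda>u. tensor_lift K V W Z (t u)) Y"
proof -
  let ?l = "tensor_lift K (tensor K U V) W Z (\<lambda>X w. tensor_lift K U V Z (\<lambda>u v. t u v w) X)"
    and ?r = "tensor_lift K U (tensor K V W) Z (\<lambda>u. tensor_lift K V W Z (t u))"
  let ?T = "tensor K (tensor K U V) W"
  let ?p = "\<lambda>u v w. pure_tensor K (tensor K U V) W (pure_tensor K U V u v) w"
  let ?a = "\<lambda>u. tensor_lift K V W ?T (?p u)"
  note T = UV_W.module_tensor
  note bl = bilinear_tensor_lift_left[OF UV.tensor_space_axioms VW.W.module_axioms Z t]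
    and br = bilinear_tensor_lift_right[OF UV.V.module_axioms VW.tensor_space_axioms Z t]
    and ba = bilinear_tensor_lift_right[OF UV.V.module_axioms VW.tensor_space_axioms T trilinear_pure]
  have l: "?l \<in> module_hom K ?T Z" by (rule UV_W.tensor_lift_hom[OF Z bl])
  have "?l (tensor_assoc K U V W Y) = tensor_lift K U (tensor K V W) Z (\<lambda>u X. ?l (?a u X)) Y"
    unfolding tensor_assoc_def Let_def by (rule U_VW.hom_tensor_lift[OF T Z ba l Y])
  also have "\<dots> = ?r Y"
  proof (rule U_VW.tensor_lift_cong[OF Z bilinear_map_postcompose[OF ba l] _ Y])
    fix u X assume u: "u \<in> carrier U" and X: "X \<in> carrier (tensor K V W)"
    \<comment> \<open>For fixed \<open>u\<close> both sides are linear in \<open>X\<close>, so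
      \<open>X\<close> may be taken pure; there all lifts evaluate and leave
      \<open>t u v w\<close>.\<close>
    show "?l (?a u X) = tensor_lift K V W Z (t u) X"
    proof (rule VW.tensor_lift_unique[OF Z _ trilinear_mapD(1)[OF t u] _ X])
      show "(\<lambda>X. ?l (?a u X)) \<in> module_hom K (tensor K V W) Z"
        by (rule module_hom_compose[OF bilinear_mapD(2)[OF ba u] l])
      fix v w assume v: "v \<in> carrier V" and w: "w \<in> carrier W"
      show "?l (?a u (pure_tensor K V W v w)) = t u v w"
        using u v w trilinear_mapD(2)[OF t]
        by (simp add: VW.tensor_lift_pure[OF T trilinear_mapD(1)[OF trilinear_pure]]
            UV_W.tensor_lift_pure[OF Z bl] UV.tensor_lift_pure[OF Z] UV.pure_closed)
    qed
  qed
  finally show ?thesis .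
qed

end

section \<open>Coassociativity of a coaction in terms of trilinear maps\<close>

context right_comodule
begin

sublocale MC: tensor_space K M C
  by (intro tensor_space.intro M.module_axioms C.module_axioms)

sublocale CC: tensor_space K C C
  by (intro tensor_space.intro C.module_axioms)

sublocale MCC: triple_tensor_space K M C C
  by (intro triple_tensor_space.intro MC.tensor_space_axioms CC.tensor_space_axioms)

lemma coact_closed: "m \<in> carrier M \<Longrightarrow> \<rho> m \<in> carrier (tensor K M C)"
  by (rule module_hom_in_carrier[OF coact_hom])

text \<open>In Sweedler notation, \<open>\<Sum> t (m\<^sub>0)\<^sub>0 (m\<^sub>0)\<^sub>1 m\<^sub>1 = \<Sum> t m\<^sub>0 (m\<^sub>1)\<^sub>1 (m\<^sub>1)\<^sub>2\<close>.\<close>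

lemma tensor_lift_coassoc:
  assumes Z: "module K Z" and t: "trilinear_map K M C C Z t" and m: "m \<in> carrier M"
  shows "tensor_lift K M C Z (\<lambda>x c. tensor_lift K M C Z (\<lambda>y d. t y d c) (\<rho> x)) (\<rho> m) =
    tensor_lift K M C Z (\<lambda>x c. tensor_lift K C C Z (t x) (\<Delta> c)) (\<rho> m)"
proof -
  interpret \<rho>: tensor_map_space K M C "tensor K M C" C \<rho> "\<lambda>x. x"
    by (intro tensor_map_space.intro tensor_map_space_axioms.intro MC.tensor_space_axioms
        MCC.UV_W.tensor_space_axioms coact_hom module_hom_id)
  interpret \<Delta>: tensor_map_space K M C M "tensor K C C" "\<lambda>x. x" \<Delta>
    by (intro tensor_map_space.intro tensor_map_space_axioms.intro MC.tensor_space_axioms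
        MCC.U_VW.tensor_space_axioms C.comult_hom module_hom_id)
  note bl = bilinear_tensor_lift_left[OF MC.tensor_space_axioms C.module_axioms Z t]
    and br = bilinear_tensor_lift_right[OF M.module_axioms CC.tensor_space_axioms Z t]
  \<comment> \<open>Read backwards, the rule turns the nested sum into a lift evaluated at one side
    of the coassociativity law.\<close>
  note \<rho>.tensor_lift_map[OF Z bl coact_closed[OF m], symmetric]
  also note coact_coassoc[OF m]
  also note MCC.tensor_lift_assoc[OF Z t module_hom_in_carrier[OF \<Delta>.tensor_map_hom coact_closed[OF m]]]
  also note \<Delta>.tensor_lift_map[OF Z br coact_closed[OF m]]
  finally show ?thesis .
qed

end

text \<open>The two coassociativity laws are the same formula when \<open>M\<close> is
  \<open>C\<close> and \<open>\<rho>\<close> is \<open>\<Delta>\<close>. Facts on rational actions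
  thus apply to the dual acting on \<open>C\<close>.\<close>

lemma (in coalgebra) right_comodule_self: "right_comodule K C \<Delta> C \<Delta>"
  by (intro right_comodule.intro right_comodule_axioms.intro coalgebra_axioms vectorspace_axioms
      comult_hom coassoc)

section \<open>The dual algebra\<close>

lemma self_space_simps:
  "carrier (self_space K) = carrier K" "add (self_space K) = add K" "zero (self_space K) = zero K"
  "smult (self_space K) = mult K"
  by (simp_all add: self_space_def)

lemma (in cring) module_self_space: "module R (self_space R)"
proof (rule moduleI)
  show "abelian_group (self_space R)"
    by (rule abelian_groupI)
      (auto simp: self_space_simps a_ac intro: bexI[of _ "\<ominus> _"] l_neg)
qed (auto simp: self_space_simps l_distr r_distr m_assoc cring_axioms)

lemma (in cring) bilinear_mult: "bilinear_map R (self_space R) (self_space R) (self_space R) (mult R)"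
  by (rule bilinear_mapI; rule module_homI)
    (auto simp: self_space_simps l_distr r_distr m_assoc m_lcomm)

text \<open>The vector comes first and the scalar second, following the order of the factors of M
  \<otimes> C.\<close>

lemma (in module) bilinear_smult: "bilinear_map R M (self_space R) M (\<lambda>x k. k \<odot>\<^bsub>M\<^esub> x)"
  by (rule bilinear_mapI; rule module_homI)
    (auto simp: self_space_simps smult_l_distr smult_r_distr smult_assoc1[symmetric] R.m_comm)

context coalgebra
begin

lemma dual_algebra_simps:
  "carrier (dual_algebra K C \<Delta>) = module_hom K C (self_space K) \<inter> extensional (carrier C)"
  "\<zero>\<^bsub>dual_algebra K C \<Delta>\<^esub> = (\<lambda>c\<in>carrier C. \<zero>\<^bsub>K\<^esub>)"
  "f \<oplus>\<^bsub>dual_algebra K C \<Delta>\<^esub> g = (\<lambda>c\<in>carrier C. f c \<oplus>\<^bsub>K\<^esub> g c)"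
  "k \<odot>\<^bsub>dual_algebra K C \<Delta>\<^esub> f = (\<lambda>c\<in>carrier C. k \<otimes>\<^bsub>K\<^esub> f c)"
  "f \<otimes>\<^bsub>dual_algebra K C \<Delta>\<^esub> g =
    (\<lambda>c\<in>carrier C. tensor_lift K C C (self_space K) (\<lambda>a b. f a \<otimes>\<^bsub>K\<^esub> g b) (\<Delta> c))"
  by (simp_all add: dual_algebra_def R.func_space_def)

lemma functional_closed: "f \<in> module_hom K C (self_space K) \<Longrightarrow> c \<in> carrier C \<Longrightarrow> f c \<in> carrier K"
  using module_hom_in_carrier[of f K C "self_space K"] by (simp add: self_space_simps)

lemma restrict_functional:
  assumes f: "f \<in> module_hom K C (self_space K)"
  shows "restrict f (carrier C) \<in> carrier (dual_algebra K C \<Delta>)"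
  unfolding dual_algebra_simps
  by (rule IntI[OF module_homI])
    (simp_all add: module_hom_in_carrier[OF f] module_hom_add[OF f] module_hom_smult[OF f])

lemma module_dual_algebra: "module K (dual_algebra K C \<Delta>)"
proof -
  interpret D: module K "R.func_space (carrier C)" by (rule R.func_space_is_module)
  let ?H = "carrier (dual_algebra K C \<Delta>)"
  have "LinearCombinations.submodule K ?H (R.func_space (carrier C))"
  proof
    show "?H \<subseteq> carrier (R.func_space (carrier C))"
      by (auto simp: dual_algebra_simps R.func_space_def PiE_def functional_closed)
    show "\<zero>\<^bsub>R.func_space (carrier C)\<^esub> \<in> ?H"
      by (auto simp: dual_algebra_simps R.func_space_def self_space_simps intro!: module_homI)
  next
    fix f g assume "f \<in> ?H" "g \<in> ?H"
    then have "(\<lambda>c. f c \<oplus>\<^bsub>K\<^esub> g c) \<in> module_hom K C (self_space K)"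
      using module_hom_sum[OF R.module_self_space, of f C g]
      by (simp add: dual_algebra_simps self_space_simps)
    from restrict_functional[OF this] show "f \<oplus>\<^bsub>R.func_space (carrier C)\<^esub> g \<in> ?H"
      by (simp add: R.func_space_def)
  next
    fix k f assume "k \<in> carrier K" "f \<in> ?H"
    then have "(\<lambda>c. k \<otimes>\<^bsub>K\<^esub> f c) \<in> module_hom K C (self_space K)"
      using module_hom_scaled[OF R.module_self_space, of f C k]
      by (simp add: dual_algebra_simps self_space_simps)
    from restrict_functional[OF this] show "k \<odot>\<^bsub>R.func_space (carrier C)\<^esub> f \<in> ?H"
      by (simp add: R.func_space_def)
  qed
  \<comment> \<open>The two records differ only in the field \<open>mult\<close>, so the identity
    map transports the module structure.\<close>
  from D.submodule_is_module[OF this] show ?thesis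
    by (rule module_surj_image[where \<pi> = "\<lambda>f. f"])
      (auto simp: dual_algebra_simps R.func_space_def)
qed

lemma dual_algebra_hom: "f \<in> carrier (dual_algebra K C \<Delta>) \<Longrightarrow> f \<in> module_hom K C (self_space K)"
  by (simp add: dual_algebra_simps)

lemma dual_algebra_eqI:
  assumes "f \<in> carrier (dual_algebra K C \<Delta>)" "g \<in> carrier (dual_algebra K C \<Delta>)"
    and "\<And>c. c \<in> carrier C \<Longrightarrow> f c = g c"
  shows "f = g"
  using assms by (auto simp: dual_algebra_simps intro: extensionalityI)

lemma bilinear_functionals:
  assumes "f \<in> module_hom K C (self_space K)" "g \<in> module_hom K C (self_space K)"
  shows "bilinear_map K C C (self_space K) (\<lambda>a b. f a \<otimes>\<^bsub>K\<^esub> g b)"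
  by (rule bilinear_map_precompose[OF R.bilinear_mult assms])

lemma dual_mult_closed:
  assumes "f \<in> carrier (dual_algebra K C \<Delta>)" "g \<in> carrier (dual_algebra K C \<Delta>)"
  shows "f \<otimes>\<^bsub>dual_algebra K C \<Delta>\<^esub> g \<in> carrier (dual_algebra K C \<Delta>)"
proof -
  interpret CC: tensor_space K C C by (intro tensor_space.intro module_axioms)
  have "(\<lambda>c. tensor_lift K C C (self_space K) (\<lambda>a b. f a \<otimes>\<^bsub>K\<^esub> g b) (\<Delta> c))
      \<in> module_hom K C (self_space K)"
    by (intro module_hom_compose[OF comult_hom] CC.tensor_lift_hom R.module_self_space
        bilinear_functionals dual_algebra_hom assms)
  from restrict_functional[OF this] show ?thesis by (simp only: dual_algebra_simps(5))
qed

end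

section \<open>The rational action of the dual\<close>

context right_comodule
begin

lemma bilinear_act:
  "a \<in> module_hom K C (self_space K) \<Longrightarrow> bilinear_map K M C M (\<lambda>x c. a c \<odot>\<^bsub>M\<^esub> x)"
  by (rule bilinear_map_precompose[OF M.bilinear_smult module_hom_id])

lemma rational_act_hom:
  assumes "a \<in> module_hom K C (self_space K)"
  shows "rational_act K C M \<rho> a \<in> module_hom K M M"
  unfolding rational_act_def
  by (rule module_hom_compose[OF coact_hom MC.tensor_lift_hom[OF M.module_axioms bilinear_act[OF assms]]])

text \<open>Linearity carries \<open>h\<close> under the Sweedler sum. In the uses \<open>h\<close>
  is a functional, a scaling, the action of another functional, or an endomorphism of
  \<open>M\<close>.\<close>

lemma hom_rational_act:
  assumes "a \<in> module_hom K C (self_space K)" "module K U" "h \<in> module_hom K M U" "m \<in> carrier M"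
  shows "h (rational_act K C M \<rho> a m) = tensor_lift K M C U (\<lambda>x c. a c \<odot>\<^bsub>U\<^esub> h x) (\<rho> m)"
proof -
  note b = bilinear_act[OF assms(1)]
  have "h (rational_act K C M \<rho> a m) = tensor_lift K M C U (\<lambda>x c. h (a c \<odot>\<^bsub>M\<^esub> x)) (\<rho> m)"
    unfolding rational_act_def
    by (rule MC.hom_tensor_lift[OF M.module_axioms assms(2) b assms(3) coact_closed[OF assms(4)]])
  also have "\<dots> = tensor_lift K M C U (\<lambda>x c. a c \<odot>\<^bsub>U\<^esub> h x) (\<rho> m)"
    by (rule MC.tensor_lift_cong[OF assms(2) bilinear_map_postcompose[OF b assms(3)] _
          coact_closed[OF assms(4)]])
      (simp add: module_hom_smult[OF assms(3)] C.functional_closed[OF assms(1)])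
  finally show ?thesis .
qed

lemma rational_act_cong:
  assumes "a \<in> module_hom K C (self_space K)" "\<And>c. c \<in> carrier C \<Longrightarrow> a c = a' c" "m \<in> carrier M"
  shows "rational_act K C M \<rho> a m = rational_act K C M \<rho> a' m"
  unfolding rational_act_def
  by (rule MC.tensor_lift_cong[OF M.module_axioms bilinear_act[OF assms(1)] _ coact_closed[OF assms(3)]])
    (simp add: assms(2))

lemma rational_act_hom_left:
  assumes "m \<in> carrier M"
  shows "(\<lambda>a. rational_act K C M \<rho> a m) \<in> module_hom K (dual_algebra K C \<Delta>) M"
  unfolding rational_act_def
proof (rule MC.tensor_lift_parameter_hom[OF M.module_axioms C.module_dual_algebra])
  show "bilinear_map K M C M (\<lambda>x c. a c \<odot>\<^bsub>M\<^esub> x)" if "a \<in> carrier (dual_algebra K C \<Delta>)" for a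
    by (rule bilinear_act[OF C.dual_algebra_hom[OF that]])
  show "(\<lambda>a. a c \<odot>\<^bsub>M\<^esub> x) \<in> module_hom K (dual_algebra K C \<Delta>) M"
    if "x \<in> carrier M" "c \<in> carrier C" for x c
  proof -
    \<comment> \<open>Evaluation at \<open>c\<close> is linear in \<open>a\<close>, and the
      resulting scalar then multiplies the fixed vector \<open>x\<close>.\<close>
    have "(\<lambda>a. a c) \<in> module_hom K (dual_algebra K C \<Delta>) (self_space K)"
      using that by (intro module_homI)
        (auto simp: C.dual_algebra_simps self_space_simps C.functional_closed)
    then show ?thesis by (rule module_hom_compose[OF _ bilinear_mapD(2)[OF M.bilinear_smult that(1)]])
  qed
  show "\<rho> m \<in> carrier (tensor K M C)" by (rule coact_closed[OF assms])
qed

text \<open>On the left \<open>a\<close> and \<open>b\<close> read the two halves of m1; by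
  coassociativity \<open>a\<close> may read the C-part of \<open>\<rho>\<close> at m0 and
  \<open>b\<close> all of m1. So \<open>b\<close> acts first, which is why a right comodule yields a
  left module.\<close>

lemma rational_act_mult:
  assumes a: "a \<in> carrier (dual_algebra K C \<Delta>)" and b: "b \<in> carrier (dual_algebra K C \<Delta>)"
    and m: "m \<in> carrier M"
  shows "rational_act K C M \<rho> (a \<otimes>\<^bsub>dual_algebra K C \<Delta>\<^esub> b) m =
    rational_act K C M \<rho> a (rational_act K C M \<rho> b m)"
proof -
  note ah = C.dual_algebra_hom[OF a] and bh = C.dual_algebra_hom[OF b]
  note abh = C.dual_algebra_hom[OF C.dual_mult_closed[OF a b]]
  note ac = C.functional_closed[OF ah] and bc = C.functional_closed[OF bh]
  note bl = C.bilinear_functionals[OF ah bh]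
  let ?t = "\<lambda>x d e. (a d \<otimes>\<^bsub>K\<^esub> b e) \<odot>\<^bsub>M\<^esub> x"
  have t: "trilinear_map K M C C M ?t"
    by (rule trilinear_mapI)
      (auto intro: bilinear_map_postcompose[OF bl bilinear_mapD(2)[OF M.bilinear_smult]]
        bilinear_map_precompose[OF M.bilinear_smult module_hom_id bilinear_mapD(1)[OF bl]])
  have "rational_act K C M \<rho> (a \<otimes>\<^bsub>dual_algebra K C \<Delta>\<^esub> b) m =
    tensor_lift K M C M (\<lambda>x c. tensor_lift K C C M (?t x) (\<Delta> c)) (\<rho> m)"
    unfolding rational_act_def
  proof (rule MC.tensor_lift_cong[OF M.module_axioms bilinear_act[OF abh] _ coact_closed[OF m]])
    fix x c assume x: "x \<in> carrier M" and c: "c \<in> carrier C"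
    \<comment> \<open>Multiplying the fixed vector \<open>x\<close> by a scalar is linear in the
      scalar, so it passes inside the lift that defines the convolution product.\<close>
    show "(a \<otimes>\<^bsub>dual_algebra K C \<Delta>\<^esub> b) c \<odot>\<^bsub>M\<^esub> x = tensor_lift K C C M (?t x) (\<Delta> c)"
      using CC.hom_tensor_lift[OF C.R.module_self_space M.module_axioms bl
          bilinear_mapD(2)[OF M.bilinear_smult x] module_hom_in_carrier[OF C.comult_hom c]] c
      by (simp add: C.dual_algebra_simps)
  qed
  also have "\<dots> = tensor_lift K M C M (\<lambda>x c. tensor_lift K M C M (\<lambda>y d. ?t y d c) (\<rho> x)) (\<rho> m)"
    by (rule tensor_lift_coassoc[OF M.module_axioms t m, symmetric])
  also have "\<dots> = tensor_lift K M C M (\<lambda>x c. b c \<odot>\<^bsub>M\<^esub> rational_act K C M \<rho> a x) (\<rho> m)"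
  \<comment> \<open>In the inner sum over \<open>\<rho> x\<close> the factor \<open>b c\<close> is
    constant; taken out, it leaves the action of \<open>a\<close> on \<open>x\<close>.\<close>
  proof (rule MC.tensor_lift_cong[symmetric, OF M.module_axioms _ _ coact_closed[OF m]])
    show "bilinear_map K M C M (\<lambda>x c. b c \<odot>\<^bsub>M\<^esub> rational_act K C M \<rho> a x)"
      by (rule bilinear_map_precompose[OF bilinear_act[OF bh] rational_act_hom[OF ah] module_hom_id])
    fix x c assume x: "x \<in> carrier M" and c: "c \<in> carrier C"
    have "b c \<odot>\<^bsub>M\<^esub> rational_act K C M \<rho> a x =
      tensor_lift K M C M (\<lambda>y d. a d \<odot>\<^bsub>M\<^esub> (b c \<odot>\<^bsub>M\<^esub> y)) (\<rho> x)"
      by (rule hom_rational_act[OF ah M.module_axioms _ x])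
        (rule module_hom_scaled[OF M.module_axioms module_hom_id bc[OF c]])
    also have "\<dots> = tensor_lift K M C M (\<lambda>y d. ?t y d c) (\<rho> x)"
      by (rule MC.tensor_lift_cong[symmetric, OF M.module_axioms trilinear_mapD(2)[OF t c] _
            coact_closed[OF x]])
        (simp add: M.smult_assoc1 ac bc c)
    finally show "b c \<odot>\<^bsub>M\<^esub> rational_act K C M \<rho> a x =
      tensor_lift K M C M (\<lambda>y d. ?t y d c) (\<rho> x)" .
  qed
  also have "\<dots> = rational_act K C M \<rho> a (rational_act K C M \<rho> b m)"
    by (rule hom_rational_act[OF bh M.module_axioms rational_act_hom[OF ah] m, symmetric])
  finally show ?thesis .
qed

end

context coalgebra
begin

text \<open>Associativity of the convolution product and its linearity in the second factor are the
  corresponding properties of the rational action of the dual on \<open>C\<close> itself, because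
  \<open>(f g) c = f (g . c)\<close>.\<close>

lemma dual_mult_eq_act:
  assumes f: "f \<in> carrier (dual_algebra K C \<Delta>)" and g: "g \<in> carrier (dual_algebra K C \<Delta>)"
    and c: "c \<in> carrier C"
  shows "(f \<otimes>\<^bsub>dual_algebra K C \<Delta>\<^esub> g) c = f (rational_act K C C \<Delta> g c)"
proof -
  interpret self: right_comodule K C \<Delta> C \<Delta> by (rule right_comodule_self)
  note fh = dual_algebra_hom[OF f] and gh = dual_algebra_hom[OF g]
  have "f (rational_act K C C \<Delta> g c) =
    tensor_lift K C C (self_space K) (\<lambda>a b. g b \<odot>\<^bsub>self_space K\<^esub> f a) (\<Delta> c)"
    by (rule self.hom_rational_act[OF gh R.module_self_space fh c])
  also have "\<dots> = tensor_lift K C C (self_space K) (\<lambda>a b. f a \<otimes>\<^bsub>K\<^esub> g b) (\<Delta> c)"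
    by (rule self.MC.tensor_lift_cong[symmetric, OF R.module_self_space bilinear_functionals[OF fh gh]
          _ self.coact_closed[OF c]])
      (simp add: self_space_simps R.m_comm functional_closed[OF fh] functional_closed[OF gh])
  finally show ?thesis using c by (simp add: dual_algebra_simps)
qed

text \<open>With g . c for the action on \<open>C\<close>: ((f g) h) c = (f g) (h . c) = f (g . (h .
  c)) = f ((g h) . c) = (f (g h)) c. Linearity in the first factor is the pointwise definition of
  sums and multiples, evaluated at g . c.\<close>

lemma assoc_algebra_dual: "assoc_algebra K (dual_algebra K C \<Delta>)"
proof -
  interpret self: right_comodule K C \<Delta> C \<Delta> by (rule right_comodule_self)
  interpret D: module K "dual_algebra K C \<Delta>" by (rule module_dual_algebra)
  note hom = dual_algebra_hom
  note simps = dual_mult_eq_act dual_mult_closed module_hom_in_carrier[OF self.rational_act_hom[OF hom]]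
    module_hom_add[OF self.rational_act_hom_left] module_hom_smult[OF self.rational_act_hom_left]
    module_hom_add[OF hom] module_hom_smult[OF hom] self.rational_act_mult
  have add: "(f \<oplus>\<^bsub>dual_algebra K C \<Delta>\<^esub> g) c = f c \<oplus>\<^bsub>K\<^esub> g c" if "c \<in> carrier C" for f g c
    using that by (simp add: dual_algebra_simps)
  have smult: "(k \<odot>\<^bsub>dual_algebra K C \<Delta>\<^esub> g) c = k \<otimes>\<^bsub>K\<^esub> g c" if "c \<in> carrier C" for k g c
    using that by (simp add: dual_algebra_simps)
  show ?thesis
    by (intro assoc_algebra.intro assoc_algebra_axioms.intro vectorspace.intro module_dual_algebra
        field_axioms dual_algebra_eqI dual_mult_closed D.M.a_closed D.smult_closed; (assumption)?)
      (simp_all add: simps add smult self_space_simps)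
qed

end

section \<open>Rota-Baxter operators\<close>

context coalgebra
begin

lemma dual_op_closed:
  assumes "P \<in> module_hom K C C" "f \<in> carrier (dual_algebra K C \<Delta>)"
  shows "dual_op C P f \<in> carrier (dual_algebra K C \<Delta>)"
  unfolding dual_op_def
  by (rule restrict_functional[OF module_hom_compose[OF assms(1) dual_algebra_hom[OF assms(2)]]])

text \<open>Extensionality makes the restriction harmless. An identity leg of a tensor map can thus
  be treated like any other operator.\<close>

lemma dual_op_id: "f \<in> carrier (dual_algebra K C \<Delta>) \<Longrightarrow> dual_op C (\<lambda>x. x) f = f"
  unfolding dual_op_def dual_algebra_simps by (auto intro: extensional_restrict)

lemma dual_op_hom:
  assumes P: "P \<in> module_hom K C C"
  shows "dual_op C P \<in> module_hom K (dual_algebra K C \<Delta>) (dual_algebra K C \<Delta>)"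
proof -
  interpret D: module K "dual_algebra K C \<Delta>" by (rule module_dual_algebra)
  show ?thesis
    by (rule module_homI; (rule dual_algebra_eqI)?)
      (simp_all add: dual_op_closed[OF P] module_hom_in_carrier[OF P],
        simp_all add: dual_op_def dual_algebra_simps module_hom_in_carrier[OF P])
qed

text \<open>Operators on the legs of a tensor move onto the functionals that read them. With
  \<open>dual_op_id\<close> this handles P \<otimes> P, id \<otimes> P and P \<otimes> id
  uniformly.\<close>

lemma dual_mult_tensor_map:
  assumes P: "P \<in> module_hom K C C" and Q: "Q \<in> module_hom K C C"
    and f: "f \<in> carrier (dual_algebra K C \<Delta>)" and g: "g \<in> carrier (dual_algebra K C \<Delta>)"
    and c: "c \<in> carrier C"
  shows "tensor_lift K C C (self_space K) (\<lambda>a b. f a \<otimes>\<^bsub>K\<^esub> g b) (tensor_map K C C C C P Q (\<Delta> c)) =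
    (dual_op C P f \<otimes>\<^bsub>dual_algebra K C \<Delta>\<^esub> dual_op C Q g) c"
proof -
  interpret CC: tensor_space K C C by (intro tensor_space.intro module_axioms)
  interpret PQ: tensor_map_space K C C C C P Q
    by (intro tensor_map_space.intro tensor_map_space_axioms.intro CC.tensor_space_axioms P Q)
  have \<Delta>c: "\<Delta> c \<in> carrier (tensor K C C)" by (rule module_hom_in_carrier[OF comult_hom c])
  note bl = bilinear_functionals[OF dual_algebra_hom dual_algebra_hom]
  have "tensor_lift K C C (self_space K) (\<lambda>a b. f a \<otimes>\<^bsub>K\<^esub> g b) (tensor_map K C C C C P Q (\<Delta> c)) =
    tensor_lift K C C (self_space K) (\<lambda>a b. f (P a) \<otimes>\<^bsub>K\<^esub> g (Q b)) (\<Delta> c)"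
    by (rule PQ.tensor_lift_map[OF R.module_self_space bl[OF f g] \<Delta>c])
  also have "\<dots> = tensor_lift K C C (self_space K) (\<lambda>a b. dual_op C P f a \<otimes>\<^bsub>K\<^esub> dual_op C Q g b) (\<Delta> c)"
    by (rule CC.tensor_lift_cong[symmetric, OF R.module_self_space
          bl[OF dual_op_closed[OF P f] dual_op_closed[OF Q g]] _ \<Delta>c])
      (simp add: dual_op_def)
  finally show ?thesis using c by (simp add: dual_algebra_simps)
qed

text \<open>The counit laws are equations in \<open>C\<close>; applying a functional
  \<open>f\<close> and moving it under the sum gives the unit laws at \<open>c\<close>. Restriction
  makes the counit extensional.\<close>

lemma counit_is_unit:
  assumes "is_counit K C \<Delta> \<epsilon>"
  shows "is_algebra_unit (dual_algebra K C \<Delta>) (restrict \<epsilon> (carrier C))"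
proof -
  interpret CC: tensor_space K C C by (intro tensor_space.intro module_axioms)
  let ?e = "restrict \<epsilon> (carrier C)"
  have \<epsilon>: "\<epsilon> \<in> module_hom K C (self_space K)"
    and counit: "\<And>c. c \<in> carrier C \<Longrightarrow> tensor_lift K C C C (\<lambda>a b. \<epsilon> a \<odot>\<^bsub>C\<^esub> b) (\<Delta> c) = c"
      "\<And>c. c \<in> carrier C \<Longrightarrow> tensor_lift K C C C (\<lambda>a b. \<epsilon> b \<odot>\<^bsub>C\<^esub> a) (\<Delta> c) = c"
    using assms by (auto simp: is_counit_def)
  note e = restrict_functional[OF \<epsilon>]
  have bl: "bilinear_map K C C C (\<lambda>a b. \<epsilon> b \<odot>\<^bsub>C\<^esub> a)"
    by (rule bilinear_map_precompose[OF bilinear_smult module_hom_id \<epsilon>])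
  \<comment> \<open>Bilinearity is symmetric in the two arguments, which here both range over
    \<open>C\<close>.\<close>
  have br: "bilinear_map K C C C (\<lambda>a b. \<epsilon> a \<odot>\<^bsub>C\<^esub> b)"
    using bl by (simp add: bilinear_map_def)
  have "?e \<otimes>\<^bsub>dual_algebra K C \<Delta>\<^esub> f = f \<and> f \<otimes>\<^bsub>dual_algebra K C \<Delta>\<^esub> ?e = f"
    if f: "f \<in> carrier (dual_algebra K C \<Delta>)" for f
  proof (intro conjI dual_algebra_eqI dual_mult_closed e f)
    fix c assume c: "c \<in> carrier C"
    have \<Delta>c: "\<Delta> c \<in> carrier (tensor K C C)" by (rule module_hom_in_carrier[OF comult_hom c])
    note fh = dual_algebra_hom[OF f]
    note h = CC.hom_tensor_lift[OF module_axioms R.module_self_space _ fh \<Delta>c]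
    note fe = functional_closed[OF fh] functional_closed[OF \<epsilon>]
    have "(?e \<otimes>\<^bsub>dual_algebra K C \<Delta>\<^esub> f) c =
      tensor_lift K C C (self_space K) (\<lambda>a b. f (\<epsilon> a \<odot>\<^bsub>C\<^esub> b)) (\<Delta> c)"
      unfolding dual_algebra_simps restrict_apply'[OF c]
      by (rule CC.tensor_lift_cong[symmetric, OF R.module_self_space bilinear_map_postcompose[OF br fh]
            _ \<Delta>c])
        (simp add: module_hom_smult[OF fh] fe self_space_simps)
    then show "(?e \<otimes>\<^bsub>dual_algebra K C \<Delta>\<^esub> f) c = f c" using h[OF br] counit(1)[OF c] by simp
    have "(f \<otimes>\<^bsub>dual_algebra K C \<Delta>\<^esub> ?e) c =
      tensor_lift K C C (self_space K) (\<lambda>a b. f (\<epsilon> b \<odot>\<^bsub>C\<^esub> a)) (\<Delta> c)"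
      unfolding dual_algebra_simps restrict_apply'[OF c]
      by (rule CC.tensor_lift_cong[symmetric, OF R.module_self_space bilinear_map_postcompose[OF bl fh]
            _ \<Delta>c])
        (simp add: module_hom_smult[OF fh] fe self_space_simps R.m_comm)
    then show "(f \<otimes>\<^bsub>dual_algebra K C \<Delta>\<^esub> ?e) c = f c" using h[OF bl] counit(2)[OF c] by simp
  qed
  then show ?thesis using e by (simp add: is_algebra_unit_def)
qed

end

text \<open>Pairing the identity at \<open>c\<close> with x \<otimes> y moves operators on the legs
  onto \<open>x\<close> and \<open>y\<close>; the \<open>P\<close> inside
  \<open>\<Delta> (P c)\<close> becomes \<open>dual_op C P\<close> applied to the whole
  product.\<close>

lemma (in rota_baxter_coalgebra) rota_baxter_algebra_dual:
  "rota_baxter_algebra K (dual_algebra K C \<Delta>) (dual_op C P) lam"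
proof (intro rota_baxter_algebra.intro rota_baxter_algebra_axioms.intro assoc_algebra_dual weight
    dual_op_hom P_hom)
  interpret CC: tensor_space K C C by (intro tensor_space.intro module_axioms)
  interpret D: module K "dual_algebra K C \<Delta>" by (rule module_dual_algebra)
  fix x y assume x: "x \<in> carrier (dual_algebra K C \<Delta>)" and y: "y \<in> carrier (dual_algebra K C \<Delta>)"
  note closed = dual_op_closed[OF P_hom] dual_mult_closed D.M.a_closed D.smult_closed x y weight
  show "dual_op C P x \<otimes>\<^bsub>dual_algebra K C \<Delta>\<^esub> dual_op C P y =
    dual_op C P (x \<otimes>\<^bsub>dual_algebra K C \<Delta>\<^esub> dual_op C P y)
    \<oplus>\<^bsub>dual_algebra K C \<Delta>\<^esub> dual_op C P (dual_op C P x \<otimes>\<^bsub>dual_algebra K C \<Delta>\<^esub> y)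
    \<oplus>\<^bsub>dual_algebra K C \<Delta>\<^esub> lam \<odot>\<^bsub>dual_algebra K C \<Delta>\<^esub> dual_op C P (x \<otimes>\<^bsub>dual_algebra K C \<Delta>\<^esub> y)"
  proof (rule dual_algebra_eqI)
    fix c assume c: "c \<in> carrier C"
    have Pc: "P c \<in> carrier C" by (rule module_hom_in_carrier[OF P_hom c])
    let ?l = "tensor_lift K C C (self_space K) (\<lambda>a b. x a \<otimes>\<^bsub>K\<^esub> y b)"
    have l: "?l \<in> module_hom K (tensor K C C) (self_space K)"
      by (rule CC.tensor_lift_hom[OF R.module_self_space
            bilinear_functionals[OF dual_algebra_hom[OF x] dual_algebra_hom[OF y]]])
    have \<Delta>: "\<Delta> (P c) \<in> carrier (tensor K C C)" by (rule module_hom_in_carrier[OF comult_hom Pc])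
    have map_closed: "tensor_map K C C C C f g (\<Delta> (P c)) \<in> carrier (tensor K C C)"
      if "f \<in> module_hom K C C" "g \<in> module_hom K C C" for f g
      by (intro module_hom_in_carrier[OF tensor_map_space.tensor_map_hom[of K C C C C f g]]
          tensor_map_space.intro tensor_map_space_axioms.intro CC.tensor_space_axioms that \<Delta>)
    have "(dual_op C P x \<otimes>\<^bsub>dual_algebra K C \<Delta>\<^esub> dual_op C P y) c =
        ?l (tensor_map K C C C C P P (\<Delta> c))"
      by (rule dual_mult_tensor_map[OF P_hom P_hom x y c, symmetric])
    also have "\<dots> = ?l (tensor_map K C C C C (\<lambda>x. x) P (\<Delta> (P c)))
        \<oplus>\<^bsub>K\<^esub> ?l (tensor_map K C C C C P (\<lambda>x. x) (\<Delta> (P c))) \<oplus>\<^bsub>K\<^esub> lam \<otimes>\<^bsub>K\<^esub> ?l (\<Delta> (P c))"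
      unfolding rota_baxter[OF c]
      by (rule module_hom_add_add_smult[OF CC.module_tensor l, unfolded self_space_simps])
        (intro map_closed P_hom module_hom_id \<Delta> weight)+
    also have "\<dots> = (x \<otimes>\<^bsub>dual_algebra K C \<Delta>\<^esub> dual_op C P y) (P c)
        \<oplus>\<^bsub>K\<^esub> (dual_op C P x \<otimes>\<^bsub>dual_algebra K C \<Delta>\<^esub> y) (P c)
        \<oplus>\<^bsub>K\<^esub> lam \<otimes>\<^bsub>K\<^esub> (x \<otimes>\<^bsub>dual_algebra K C \<Delta>\<^esub> y) (P c)"
      using Pc
      by (simp add: dual_mult_tensor_map[OF _ _ x y] P_hom module_hom_id dual_op_id x y
          dual_algebra_simps(5)[of x y])
    finally show "(dual_op C P x \<otimes>\<^bsub>dual_algebra K C \<Delta>\<^esub> dual_op C P y) c =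
        (dual_op C P (x \<otimes>\<^bsub>dual_algebra K C \<Delta>\<^esub> dual_op C P y)
        \<oplus>\<^bsub>dual_algebra K C \<Delta>\<^esub> dual_op C P (dual_op C P x \<otimes>\<^bsub>dual_algebra K C \<Delta>\<^esub> y)
        \<oplus>\<^bsub>dual_algebra K C \<Delta>\<^esub> lam \<odot>\<^bsub>dual_algebra K C \<Delta>\<^esub> dual_op C P (x \<otimes>\<^bsub>dual_algebra K C \<Delta>\<^esub> y)) c"
      using c by (simp add: dual_op_def dual_algebra_simps(3,4))
  qed (simp_all add: closed)
qed

section \<open>The rational module and its Rota-Baxter structure\<close>

context right_comodule
begin

lemma left_module_rational: "left_module K (dual_algebra K C \<Delta>) M (rational_act K C M \<rho>)"
proof (intro left_module.intro left_module_axioms.intro C.assoc_algebra_dual M.vectorspace_axioms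
    rational_act_mult)
  note left = rational_act_hom_left and right = rational_act_hom[OF C.dual_algebra_hom]
  fix a assume a: "a \<in> carrier (dual_algebra K C \<Delta>)"
  fix x assume x: "x \<in> carrier M"
  show "rational_act K C M \<rho> a x \<in> carrier M" by (rule module_hom_in_carrier[OF right[OF a] x])
  show "rational_act K C M \<rho> (a \<oplus>\<^bsub>dual_algebra K C \<Delta>\<^esub> b) x =
      rational_act K C M \<rho> a x \<oplus>\<^bsub>M\<^esub> rational_act K C M \<rho> b x"
    if "b \<in> carrier (dual_algebra K C \<Delta>)" for b
    by (rule module_hom_add[OF left[OF x] a that])
  show "rational_act K C M \<rho> a (x \<oplus>\<^bsub>M\<^esub> y) = rational_act K C M \<rho> a x \<oplus>\<^bsub>M\<^esub> rational_act K C M \<rho> a y"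
    if "y \<in> carrier M" for y
    by (rule module_hom_add[OF right[OF a] x that])
  show "rational_act K C M \<rho> (k \<odot>\<^bsub>dual_algebra K C \<Delta>\<^esub> a) x = k \<odot>\<^bsub>M\<^esub> rational_act K C M \<rho> a x"
    if "k \<in> carrier K" for k
    by (rule module_hom_smult[OF left[OF x] that a])
  show "rational_act K C M \<rho> a (k \<odot>\<^bsub>M\<^esub> x) = k \<odot>\<^bsub>M\<^esub> rational_act K C M \<rho> a x"
    if "k \<in> carrier K" for k
    by (rule module_hom_smult[OF right[OF a] that x])
qed

text \<open>The legs behave differently: the map on the \<open>C\<close> leg moves onto the
  functional, while the map on the \<open>M\<close> leg is linear and comes out of the sum.\<close>

lemma rational_act_tensor_map:
  assumes q: "q \<in> module_hom K M M" and P: "P \<in> module_hom K C C"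
    and a: "a \<in> carrier (dual_algebra K C \<Delta>)" and m: "m \<in> carrier M"
  shows "tensor_lift K M C M (\<lambda>x c. a c \<odot>\<^bsub>M\<^esub> x) (tensor_map K M C M C q P (\<rho> m)) =
    q (rational_act K C M \<rho> (dual_op C P a) m)"
proof -
  interpret qP: tensor_map_space K M C M C q P
    by (intro tensor_map_space.intro tensor_map_space_axioms.intro MC.tensor_space_axioms q P)
  have Pa: "dual_op C P a \<in> module_hom K C (self_space K)"
    by (rule C.dual_algebra_hom[OF C.dual_op_closed[OF P a]])
  have "tensor_lift K M C M (\<lambda>x c. a c \<odot>\<^bsub>M\<^esub> x) (tensor_map K M C M C q P (\<rho> m)) =
    tensor_lift K M C M (\<lambda>x c. a (P c) \<odot>\<^bsub>M\<^esub> q x) (\<rho> m)"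
    by (rule qP.tensor_lift_map[OF M.module_axioms bilinear_act[OF C.dual_algebra_hom[OF a]]
          coact_closed[OF m]])
  also have "\<dots> = tensor_lift K M C M (\<lambda>x c. dual_op C P a c \<odot>\<^bsub>M\<^esub> q x) (\<rho> m)"
    by (rule MC.tensor_lift_cong[symmetric, OF M.module_axioms
          bilinear_map_precompose[OF bilinear_act[OF Pa] q module_hom_id] _ coact_closed[OF m]])
      (simp add: dual_op_def)
  also have "\<dots> = q (rational_act K C M \<rho> (dual_op C P a) m)"
    by (rule hom_rational_act[OF Pa M.module_axioms q m, symmetric])
  finally show ?thesis .
qed

text \<open>The morphism condition rewrites \<open>\<rho> (q m)\<close> as q \<otimes> id applied to
  \<open>\<rho> m\<close>; the identity leg leaves \<open>a\<close> unchanged, and \<open>q\<close>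
  comes out.\<close>

lemma rational_act_morphism:
  assumes "comodule_morphism K C M \<rho> M \<rho> q"
    and a: "a \<in> carrier (dual_algebra K C \<Delta>)" and m: "m \<in> carrier M"
  shows "rational_act K C M \<rho> a (q m) = q (rational_act K C M \<rho> a m)"
  using assms rational_act_tensor_map[OF _ module_hom_id a m, of q]
  by (simp add: comodule_morphism_def rational_act_def C.dual_op_id)

end

lemma (in right_rota_baxter_comodule) left_rota_baxter_module_rational:
  assumes mor: "comodule_morphism K C M \<rho> M \<rho> p"
  shows "left_rota_baxter_module K (dual_algebra K C \<Delta>) (dual_op C P) lam M (rational_act K C M \<rho>) p"
proof (intro left_rota_baxter_module.intro left_rota_baxter_module_axioms.intro
    C.rota_baxter_algebra_dual left_module_rational p_hom)
  fix a x assume a: "a \<in> carrier (dual_algebra K C \<Delta>)" and x: "x \<in> carrier M"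
  have px: "p x \<in> carrier M" by (rule module_hom_in_carrier[OF p_hom x])
  note Pa = C.dual_op_closed[OF C.P_hom a]
  note act_p = rational_act_morphism[OF mor]
  let ?l = "tensor_lift K M C M (\<lambda>x c. a c \<odot>\<^bsub>M\<^esub> x)"
  have l: "?l \<in> module_hom K (tensor K M C) M"
    by (rule MC.tensor_lift_hom[OF M.module_axioms bilinear_act[OF C.dual_algebra_hom[OF a]]])
  have map_closed: "tensor_map K M C M C f g (\<rho> (p x)) \<in> carrier (tensor K M C)"
    if "f \<in> module_hom K M M" "g \<in> module_hom K C C" for f g
    by (intro module_hom_in_carrier[OF tensor_map_space.tensor_map_hom[of K M C M C f g]]
        tensor_map_space.intro tensor_map_space_axioms.intro MC.tensor_space_axioms that
        coact_closed[OF px])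
  have "rational_act K C M \<rho> (dual_op C P a) (p x) = p (rational_act K C M \<rho> (dual_op C P a) x)"
    by (rule act_p[OF Pa x])
  also have "\<dots> = ?l (tensor_map K M C M C p P (\<rho> x))"
    by (rule rational_act_tensor_map[OF p_hom C.P_hom a x, symmetric])
  also have "\<dots> = ?l (tensor_map K M C M C p (\<lambda>x. x) (\<rho> (p x)))
      \<oplus>\<^bsub>M\<^esub> ?l (tensor_map K M C M C (\<lambda>x. x) P (\<rho> (p x))) \<oplus>\<^bsub>M\<^esub> lam \<odot>\<^bsub>M\<^esub> ?l (\<rho> (p x))"
    unfolding rota_baxter_comod[OF x]
    by (rule module_hom_add_add_smult[OF MC.module_tensor l])
      (intro map_closed p_hom C.P_hom module_hom_id coact_closed[OF px] C.weight)+
  also have "\<dots> = p (rational_act K C M \<rho> a (p x))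
      \<oplus>\<^bsub>M\<^esub> rational_act K C M \<rho> (dual_op C P a) (p x) \<oplus>\<^bsub>M\<^esub> lam \<odot>\<^bsub>M\<^esub> rational_act K C M \<rho> a (p x)"
    using px by (simp add: rational_act_tensor_map[OF _ _ a] p_hom C.P_hom module_hom_id
        C.dual_op_id a rational_act_def[of K C M \<rho> a])
  finally show "rational_act K C M \<rho> (dual_op C P a) (p x) =
      p (rational_act K C M \<rho> a (p x)) \<oplus>\<^bsub>M\<^esub> p (rational_act K C M \<rho> (dual_op C P a) x)
      \<oplus>\<^bsub>M\<^esub> lam \<odot>\<^bsub>M\<^esub> p (rational_act K C M \<rho> a x)"
    \<comment> \<open>Moving \<open>p\<close> out of every action brings the derived equation and
      the goal to one form; the first summand is rewritten alike in both.\<close>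
    by (simp only: act_p[OF Pa x] act_p[OF a x])
qed

text \<open>Coalgebras, comodules and algebras are encoded without counit and unit; the second
  conjunct adds the counital reading, in which the counit becomes the unit of the dual and acts as
  the identity.\<close>

theorem proposition4p6:
  fixes K :: "('k, 'e) ring_scheme"
    and C :: "('k, 'c, 'f) module_scheme"
    and M :: "('k, 'm, 'g) module_scheme"
    and \<Delta> :: "'c \<Rightarrow> ('c \<times> 'c \<Rightarrow> 'k) set" and P :: "'c \<Rightarrow> 'c"
    and \<rho> :: "'m \<Rightarrow> ('m \<times> 'c \<Rightarrow> 'k) set" and p :: "'m \<Rightarrow> 'm"
    and lam :: 'k
  assumes "char_0_field K"
    and "rota_baxter_coalgebra K C \<Delta> P lam"
    and "right_rota_baxter_comodule K C \<Delta> P lam M \<rho> p"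
    and "comodule_morphism K C M \<rho> M \<rho> p"
  shows "left_rota_baxter_module K (dual_algebra K C \<Delta>) (dual_op C P) lam
           M (rational_act K C M \<rho>) p
       \<and> (\<forall>\<epsilon>. is_counit K C \<Delta> \<epsilon> \<and> is_counital K C M \<rho> \<epsilon> \<longrightarrow>
            is_algebra_unit (dual_algebra K C \<Delta>) (restrict \<epsilon> (carrier C)) \<and>
            (\<forall>m\<in>carrier M. rational_act K C M \<rho> (restrict \<epsilon> (carrier C)) m = m))"
proof -
  interpret right_rota_baxter_comodule K C \<Delta> P lam M \<rho> p by fact
  have "rational_act K C M \<rho> (restrict \<epsilon> (carrier C)) m = m"
    if "is_counit K C \<Delta> \<epsilon>" "is_counital K C M \<rho> \<epsilon>" "m \<in> carrier M" for \<epsilon> m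
    \<comment> \<open>Counitality says by definition that the counit acts as the identity; on the
      carrier of \<open>C\<close> it agrees with its restriction.\<close>
    using that rational_act_cong[of \<epsilon> "restrict \<epsilon> (carrier C)" m]
    by (simp add: is_counit_def is_counital_def rational_act_def)
  then show ?thesis
    using left_rota_baxter_module_rational[OF assms(4)] C.counit_is_unit by simp
qed

end
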